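(* Let $\Gamma=(V,E)$ be an infinite weighted graph and $x_0\in V$. If $M_{-,\infty}(x_0,\Gamma)=0$ and $\kappa_\infty(x_0,\Gamma)=0$, then $\sigma^{\mathrm{ess}}(\Gamma)=\{1\}$.
   Context: $\Gamma=(V,E)$ is a locally finite, connected graph with infinitely many vertices, equipped with symmetric edge weights $\mu_{xy}=\mu_{yx}\ge 0$, where $\mu_{xy}>0$ iff $(x,y)\in E$ (written $x\sim y$); self-loops are allowed. $\mu(x)=\sum_y\mu_{xy}$ and $d$ is the graph distance. With respect to the reference vertex $x_0$: $\mu_-(x)=\sum\mu_{xy}$ over $y\sim x$ with $d(x_0,y)=d(x_0,x)-1$; $\mu_0(x)=\sum\mu_{xy}$ over $y\sim x$ with $d(x_0,y)=d(x_0,x)$ (including $y=x$ if there is a self-loop at $x$). $M_{-,\infty}(x_0,\Gamma)=\lim_{K\uparrow\Gamma}\sup_{x\in V\setminus K}\frac{\mu_-(x)}{\mu(x)}$ and $\kappa_\infty(x_0,\Gamma)=\lim_{K\uparrow\Gamma}\sup_{x\in V\setminus K}\frac{\mu_0(x)}{\mu(x)}$, limits along any increasing sequence of finite subsets $K$ exhausting $V$. The normalized Laplace operator is the bounded self-adjoint operator on $\ell^2(V,\mu)$ (inner product $\sum_x\mu(x)f(x)g(x)$) given by $\Delta f(x)=f(x)-\frac1{\mu(x)}\sum_{y}\mu_{xy}f(y)$. $\sigma^{\mathrm{ess}}(\Gamma)$ is its essential spectrum (spectrum minus isolated eigenvalues of finite multiplicity). *)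

theory Defs
  imports "HOL-Analysis.Analysis"
begin

section \<open>Weighted graphs\<close>

text \<open>
  The vertex set is the whole type \<open>'v\<close>, and the weight function \<open>w\<close> carries the graph:
  \<open>x\<close> and \<open>y\<close> are adjacent iff \<open>w x y > 0\<close>. The case \<open>x = y\<close> (a self-loop) is allowed.
\<close>

definition edges :: "('v \<Rightarrow> 'v \<Rightarrow> real) \<Rightarrow> ('v \<times> 'v) set" where
  "edges w = {(x, y). w x y > 0}"

definition nbrs :: "('v \<Rightarrow> 'v \<Rightarrow> real) \<Rightarrow> 'v \<Rightarrow> 'v set" where
  "nbrs w x = {y. (x, y) \<in> edges w}"

locale weighted_graph =
  fixes w :: "'v \<Rightarrow> 'v \<Rightarrow> real"
  assumes weight_nonneg: "0 \<le> w x y"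
    and weight_sym: "w x y = w y x"
    and locally_finite: "finite (nbrs w x)"
    and connected: "(x, y) \<in> (edges w)\<^sup>*"

definition gdist :: "('v \<Rightarrow> 'v \<Rightarrow> real) \<Rightarrow> 'v \<Rightarrow> 'v \<Rightarrow> nat" where
  "gdist w x y = (LEAST n. (x, y) \<in> edges w ^^ n)"

definition mu :: "('v \<Rightarrow> 'v \<Rightarrow> real) \<Rightarrow> 'v \<Rightarrow> real" where
  "mu w x = (\<Sum>y\<in>nbrs w x. w x y)"

text \<open>
  The condition \<open>d(x\<^sub>0,y) = d(x\<^sub>0,x) - 1\<close> is written without subtraction: with truncated
  subtraction a self-loop at \<open>x\<^sub>0\<close> would contribute to \<open>mu_minus\<close>.
\<close>

definition mu_minus :: "('v \<Rightarrow> 'v \<Rightarrow> real) \<Rightarrow> 'v \<Rightarrow> 'v \<Rightarrow> real" where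
  "mu_minus w x0 x = (\<Sum>y\<in>{y \<in> nbrs w x. gdist w x0 y + 1 = gdist w x0 x}. w x y)"

definition mu_zero :: "('v \<Rightarrow> 'v \<Rightarrow> real) \<Rightarrow> 'v \<Rightarrow> 'v \<Rightarrow> real" where
  "mu_zero w x0 x = (\<Sum>y\<in>{y \<in> nbrs w x. gdist w x0 y = gdist w x0 x}. w x y)"


section \<open>Limits along exhaustions\<close>

definition exhaustion :: "(nat \<Rightarrow> 'v set) \<Rightarrow> bool" where
  "exhaustion K \<longleftrightarrow> incseq K \<and> (\<forall>n. finite (K n)) \<and> (\<Union>n. K n) = UNIV"

text \<open>
  The common limit of \<open>F\<close> along all exhaustions. On an infinite connected locally finite graph
  exhaustions exist (the vertex set is countable), and the two functions \<open>F\<close> below are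
  decreasing in \<open>K\<close> with values in \<open>{0..1}\<close>, so there the limit exists and is unique.
\<close>

definition exhaustion_lim :: "('v set \<Rightarrow> real) \<Rightarrow> real" where
  "exhaustion_lim F = (THE L. \<forall>K. exhaustion K \<longrightarrow> (\<lambda>n. F (K n)) \<longlonglongrightarrow> L)"

definition M_minus_inf :: "('v \<Rightarrow> 'v \<Rightarrow> real) \<Rightarrow> 'v \<Rightarrow> real" where
  "M_minus_inf w x0 = exhaustion_lim (\<lambda>K. SUP x\<in>UNIV - K. mu_minus w x0 x / mu w x)"

definition kappa_inf :: "('v \<Rightarrow> 'v \<Rightarrow> real) \<Rightarrow> 'v \<Rightarrow> real" where
  "kappa_inf w x0 = exhaustion_lim (\<lambda>K. SUP x\<in>UNIV - K. mu_zero w x0 x / mu w x)"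


section \<open>The normalized Laplacian and its essential spectrum\<close>

definition l2 :: "('v \<Rightarrow> 'v \<Rightarrow> real) \<Rightarrow> ('v \<Rightarrow> real) set" where
  "l2 w = {f. (\<lambda>x. mu w x * f x * f x) summable_on UNIV}"

definition l2_inner :: "('v \<Rightarrow> 'v \<Rightarrow> real) \<Rightarrow> ('v \<Rightarrow> real) \<Rightarrow> ('v \<Rightarrow> real) \<Rightarrow> real" where
  "l2_inner w f g = (\<Sum>\<^sub>\<infinity>x. mu w x * f x * g x)"

definition l2_norm :: "('v \<Rightarrow> 'v \<Rightarrow> real) \<Rightarrow> ('v \<Rightarrow> real) \<Rightarrow> real" where
  "l2_norm w f = sqrt (l2_inner w f f)"

definition laplacian :: "('v \<Rightarrow> 'v \<Rightarrow> real) \<Rightarrow> ('v \<Rightarrow> real) \<Rightarrow> ('v \<Rightarrow> real)" where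
  "laplacian w f x = f x - (1 / mu w x) * (\<Sum>y\<in>nbrs w x. w x y * f y)"

text \<open>
  \<open>c\<close> lies in the resolvent set of an operator \<open>T\<close> on \<open>l2 w\<close> iff \<open>T - c\<close> is a bijection of
  \<open>l2 w\<close> with bounded inverse. Only real \<open>c\<close> are considered: the Hilbert space is real, and the
  operator of interest is self-adjoint.
\<close>

definition spectrum :: "('v \<Rightarrow> 'v \<Rightarrow> real) \<Rightarrow> (('v \<Rightarrow> real) \<Rightarrow> ('v \<Rightarrow> real)) \<Rightarrow> real set" where
  "spectrum w T =
     {c. \<not> (bij_betw (\<lambda>f x. T f x - c * f x) (l2 w) (l2 w) \<and>
            (\<exists>C. \<forall>f\<in>l2 w. l2_norm w f \<le> C * l2_norm w (\<lambda>x. T f x - c * f x)))}"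

definition eigenspace ::
    "('v \<Rightarrow> 'v \<Rightarrow> real) \<Rightarrow> (('v \<Rightarrow> real) \<Rightarrow> ('v \<Rightarrow> real)) \<Rightarrow> real \<Rightarrow> ('v \<Rightarrow> real) set" where
  "eigenspace w T c = {f \<in> l2 w. \<forall>x. T f x = c * f x}"

definition eigenvalue ::
    "('v \<Rightarrow> 'v \<Rightarrow> real) \<Rightarrow> (('v \<Rightarrow> real) \<Rightarrow> ('v \<Rightarrow> real)) \<Rightarrow> real \<Rightarrow> bool" where
  "eigenvalue w T c \<longleftrightarrow> (\<exists>f\<in>eigenspace w T c. \<exists>x. f x \<noteq> 0)"

text \<open>
  The function type is not an instance of \<open>real_vector\<close>, so the existence of a finite spanning set
  is spelled out.
\<close>

definition finite_multiplicity ::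
    "('v \<Rightarrow> 'v \<Rightarrow> real) \<Rightarrow> (('v \<Rightarrow> real) \<Rightarrow> ('v \<Rightarrow> real)) \<Rightarrow> real \<Rightarrow> bool" where
  "finite_multiplicity w T c \<longleftrightarrow>
     (\<exists>B. finite B \<and> B \<subseteq> eigenspace w T c \<and>
          (\<forall>f\<in>eigenspace w T c. \<exists>a. \<forall>x. f x = (\<Sum>b\<in>B. a b * b x)))"

definition ess_spectrum ::
    "('v \<Rightarrow> 'v \<Rightarrow> real) \<Rightarrow> (('v \<Rightarrow> real) \<Rightarrow> ('v \<Rightarrow> real)) \<Rightarrow> real set" where
  "ess_spectrum w T = spectrum w T -
     {c. c isolated_in spectrum w T \<and> eigenvalue w T c \<and> finite_multiplicity w T c}"

end

theory Submission
  imports Defs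
begin

text \<open>
  The Laplacian is \<open>1 - P\<close>, where \<open>P\<close> averages a function over the neighbours of a vertex. The claim
  says that \<open>P\<close> has essential spectrum \<open>{0}\<close>, and the reason is that \<open>P\<close> is a compact self-adjoint
  operator on an infinite-dimensional Hilbert space.

  Compactness is where the hypotheses on the graph enter. For every \<open>e > 0\<close> there is a finite set
  \<open>K\<close> of vertices outside of which the ratios of \<open>mu_minus\<close> and \<open>mu_zero\<close> to \<open>mu\<close> are at most
  \<open>e\<close>. For \<open>x\<close> outside \<open>K\<close>, the edges from \<open>x\<close> to vertices that are not
  farther from \<open>x0\<close> carry a small part of the weight at \<open>x\<close>. An edge from \<open>x\<close> to a farther
  vertex \<open>y\<close> may carry most of the weight at \<open>x\<close>, but seen from \<open>y\<close> it leads towards \<open>x0\<close> and so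
  carries a small part of the weight at \<open>y\<close>. The Cauchy-Schwarz inequality and an exchange of
  summation turn this into \<open>\<parallel>P f\<parallel>\<^sup>2 \<le> 6 e \<parallel>f\<parallel>\<^sup>2\<close> for all \<open>f\<close> vanishing on \<open>K\<close> and its neighbours
  (\<open>compact_average_op\<close>).

  The spectral theory of compact self-adjoint operators then gives both inclusions. Away from \<open>0\<close>
  the Fredholm alternative shows that the spectrum of \<open>P\<close> consists of eigenvalues
  (\<open>compact_selfadjoint_fredholm\<close>), which have finite multiplicity
  (\<open>compact_op_eigenspace_finite_dim\<close>) and accumulate only at \<open>0\<close>
  (\<open>compact_selfadjoint_eigenvalues_discrete\<close>). Conversely there are infinitely many orthonormal
  eigenvectors with eigenvalues arbitrarily close to \<open>0\<close>
  (\<open>compact_selfadjoint_small_eigenvectors\<close>), so \<open>0\<close> cannot be an isolated eigenvalue of finite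
  multiplicity (\<open>one_in_ess_spectrum\<close>). The analytic core is that bounded approximate eigenvectors
  for a nonzero number have a convergent subsequence
  (\<open>compact_op_approx_eigenvectors\<close>).

  The operator theory is carried out for an abstract Hilbert space and applied to the unweighted
  space of square-summable functions, to which \<open>l2 w\<close> is unitarily equivalent.
\<close>

section \<open>Compact self-adjoint operators on a Hilbert space\<close>

definition orthonormal :: "'a::real_inner set \<Rightarrow> bool" where
  "orthonormal S \<longleftrightarrow> pairwise orthogonal S \<and> (\<forall>s\<in>S. norm s = 1)"

text \<open>
  \<open>T\<close> is small on the orthogonal complement of a finite-dimensional space, that is, it is a norm
  limit of finite-rank operators. For bounded operators on a Hilbert space this is equivalent to
  compactness, and it is the form in which the estimate on the graph arises, the finite set \<open>B\<close>
  consisting of the point masses at finitely many vertices.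
\<close>

definition compact_op :: "('a::real_inner \<Rightarrow> 'a) \<Rightarrow> bool" where
  "compact_op T \<longleftrightarrow> (\<forall>\<epsilon>>0. \<exists>B. finite B \<and> orthonormal B \<and>
     (\<forall>f. (\<forall>b\<in>B. f \<bullet> b = 0) \<longrightarrow> norm (T f) \<le> \<epsilon> * norm f))"

definition selfadjoint :: "('a::real_inner \<Rightarrow> 'a) \<Rightarrow> bool" where
  "selfadjoint T \<longleftrightarrow> (\<forall>f g. T f \<bullet> g = f \<bullet> T g)"

lemma orthonormal_independent:
  assumes "orthonormal S" shows "independent S"
  using assms unfolding orthonormal_def
  by (intro pairwise_orthogonal_independent) auto

lemma orthonormal_mono: "orthonormal S \<Longrightarrow> A \<subseteq> S \<Longrightarrow> orthonormal A"
  unfolding orthonormal_def by (auto intro: pairwise_subset)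

lemma orthonormal_inner:
  assumes "orthonormal S" "s \<in> S" "t \<in> S"
  shows "s \<bullet> t = (if s = t then 1 else 0)"
proof (cases "s = t")
  case True
  have "s \<bullet> s = 1" using assms(1,2) by (simp add: orthonormal_def norm_eq_1)
  thus ?thesis using True by simp
next
  case False
  thus ?thesis using assms by (auto simp: orthonormal_def pairwise_def orthogonal_def)
qed

lemma orthonormal_remainder:
  assumes S: "orthonormal S" "finite S" and s: "s \<in> S"
  shows "(f - (\<Sum>t\<in>S. (f \<bullet> t) *\<^sub>R t)) \<bullet> s = 0"
proof -
  have "(\<Sum>t\<in>S. (f \<bullet> t) * (t \<bullet> s)) = (\<Sum>t\<in>S. if t = s then f \<bullet> t else 0)"
    using S(1) s by (intro sum.cong refl) (auto simp: orthonormal_inner)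
  also have "\<dots> = f \<bullet> s" using S(2) s by simp
  finally show ?thesis by (simp add: inner_diff_left inner_sum_left)
qed

text \<open>
  Zorn's lemma, applied inside a set \<open>A\<close> that need not be a subspace: it serves for a single
  eigenspace as well as for the set of all eigenvectors.
\<close>

lemma maximal_orthonormal_subset:
  fixes A :: "'a::real_inner set"
  obtains S where "S \<subseteq> A" "orthonormal S"
    "\<And>a. a \<in> A \<Longrightarrow> norm a = 1 \<Longrightarrow> \<exists>s\<in>S. a \<bullet> s \<noteq> 0"
proof -
  let ?F = "{S. S \<subseteq> A \<and> orthonormal S}"
  have "\<exists>M\<in>?F. \<forall>X\<in>?F. M \<subseteq> X \<longrightarrow> X = M"
  proof (rule subset_Zorn')
    fix C assume C: "subset.chain ?F C"
    have "pairwise orthogonal (\<Union>C)"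
      using C by (intro pairwise_chain_Union) (auto simp: subset_chain_def orthonormal_def chain_subset_def)
    thus "\<Union>C \<in> ?F" using C by (auto simp: subset.chain_def orthonormal_def)
  qed
  then obtain S where S: "S \<subseteq> A" "orthonormal S" and mx: "\<And>X. X \<subseteq> A \<Longrightarrow> orthonormal X \<Longrightarrow> S \<subseteq> X \<Longrightarrow> X = S"
    by auto
  have "\<exists>s\<in>S. a \<bullet> s \<noteq> 0" if a: "a \<in> A" "norm a = 1" for a
  proof (rule ccontr)
    assume "\<not> ?thesis"
    hence z: "\<And>s. s \<in> S \<Longrightarrow> a \<bullet> s = 0" by auto
    have "orthonormal (insert a S)"
      using S(2) a z unfolding orthonormal_def
      by (auto simp: pairwise_insert orthogonal_def inner_commute)
    hence "insert a S = S" using a S by (intro mx) auto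
    hence "a \<in> S" by auto
    hence "a \<bullet> a = 0" using z by auto
    thus False using a by auto
  qed
  thus ?thesis using that S by blast
qed

lemma common_convergent_subsequence:
  fixes a :: "'b \<Rightarrow> nat \<Rightarrow> real"
  assumes "finite B" "\<And>b. b \<in> B \<Longrightarrow> bounded (range (a b))"
  shows "\<exists>r. strict_mono r \<and> (\<forall>b\<in>B. convergent (\<lambda>n. a b (r n)))"
  using assms
proof (induction B)
  case empty
  show ?case by (auto intro!: exI[of _ id] simp: strict_mono_id)
next
  case (insert b B)
  then obtain r where r: "strict_mono (r :: nat \<Rightarrow> nat)" "\<forall>b\<in>B. convergent (\<lambda>n. a b (r n))" by auto
  have "bounded (range (\<lambda>n. a b (r n)))"
    using insert.prems[of b] by (rule bounded_subset) auto
  then obtain l q where q: "strict_mono (q :: nat \<Rightarrow> nat)" "((\<lambda>n. a b (r n)) \<circ> q) \<longlonglongrightarrow> l"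
    using bounded_imp_convergent_subsequence by blast
  have "convergent (\<lambda>n. a c ((r \<circ> q) n))" if "c \<in> insert b B" for c
  proof (cases "c = b")
    case True thus ?thesis using q(2) by (auto simp: convergent_def o_def)
  next
    case False
    hence "convergent (\<lambda>n. a c (r n))" using r that by auto
    from convergent_subseq_convergent[OF this q(1)] show ?thesis by (simp add: o_def)
  qed
  thus ?case using strict_mono_o[OF r(1) q(1)] by blast
qed

text \<open>
  Choose \<open>B\<close> such that \<open>T\<close> has norm at most
  \<open>\<bar>c\<bar> / 2\<close> on the complement of \<open>B\<close>. The components of \<open>f n\<close> along \<open>B\<close> converge along a
  subsequence, since they are finitely many bounded real sequences. On the complement of \<open>B\<close> the
  operator \<open>T - c\<close> is bounded below by \<open>\<bar>c\<bar> / 2\<close>, so there convergence of \<open>(T - c) f n\<close> forces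
  that of the remaining component.
\<close>

lemma compact_op_approx_eigenvectors:
  fixes T :: "'a::{real_inner,complete_space} \<Rightarrow> 'a"
  assumes T: "bounded_linear T" "compact_op T" and c: "c \<noteq> 0"
    and f: "\<And>n. norm (f n) \<le> R" and lim: "(\<lambda>n. T (f n) - c *\<^sub>R f n) \<longlonglongrightarrow> 0"
  obtains r l where "strict_mono r" "(f \<circ> r) \<longlonglongrightarrow> l" "T l = c *\<^sub>R l"
proof -
  interpret T: bounded_linear T by fact
  define \<epsilon> where "\<epsilon> = \<bar>c\<bar> / 2"
  have \<epsilon>: "\<epsilon> > 0" using c by (simp add: \<epsilon>_def)
  then obtain B where B: "finite B" "orthonormal B"
    and small: "\<And>g. (\<And>b. b \<in> B \<Longrightarrow> g \<bullet> b = 0) \<Longrightarrow> norm (T g) \<le> \<epsilon> * norm g"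
    using T(2) unfolding compact_op_def by metis
  have "bounded (range (\<lambda>n. f n \<bullet> b))" if "b \<in> B" for b
  proof (rule boundedI[where B = R])
    fix x assume "x \<in> range (\<lambda>n. f n \<bullet> b)"
    then obtain n where "x = f n \<bullet> b" by auto
    moreover have "norm b = 1" using that B by (auto simp: orthonormal_def)
    ultimately show "norm x \<le> R" using Cauchy_Schwarz_ineq2[of "f n" b] f[of n] by simp
  qed
  from common_convergent_subsequence[OF B(1), of "\<lambda>b n. f n \<bullet> b", OF this]
  obtain r where r: "strict_mono r" and rc: "\<And>b. b \<in> B \<Longrightarrow> convergent (\<lambda>n. f (r n) \<bullet> b)" by blast
  \<comment> \<open>splitting into the component along \<open>B\<close> and the remainder\<close>
  define u where "u n = (\<Sum>b\<in>B. (f (r n) \<bullet> b) *\<^sub>R b)" for n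
  define v where "v n = f (r n) - u n" for n
  have vB: "v n \<bullet> b = 0" if "b \<in> B" for n b
    unfolding v_def u_def using B that by (intro orthonormal_remainder) auto
  obtain L where L: "\<And>b. b \<in> B \<Longrightarrow> (\<lambda>n. f (r n) \<bullet> b) \<longlonglongrightarrow> L b"
    using rc unfolding convergent_def by metis
  have u: "u \<longlonglongrightarrow> (\<Sum>b\<in>B. L b *\<^sub>R b)"
    unfolding u_def by (intro tendsto_sum tendsto_scaleR L tendsto_const)
  define h where "h n = T (v n) - c *\<^sub>R v n" for n
  have h_eq: "h = (\<lambda>n. (T (f (r n)) - c *\<^sub>R f (r n)) - (T (u n) - c *\<^sub>R u n))"
    by (rule ext) (simp add: h_def v_def T.diff algebra_simps)
  have lim': "(\<lambda>n. T (f (r n)) - c *\<^sub>R f (r n)) \<longlonglongrightarrow> 0"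
    using LIMSEQ_subseq_LIMSEQ[OF lim r] by (simp add: o_def)
  have "h \<longlonglongrightarrow> 0 - (T (\<Sum>b\<in>B. L b *\<^sub>R b) - c *\<^sub>R (\<Sum>b\<in>B. L b *\<^sub>R b))"
    unfolding h_eq by (intro tendsto_diff lim' T.tendsto[OF u] tendsto_scaleR[OF tendsto_const u])
  hence hC: "Cauchy h" by (rule LIMSEQ_imp_Cauchy)
  have est: "\<epsilon> * norm (v n - v m) \<le> norm (h n - h m)" for n m
  proof -
    define g where "g = v n - v m"
    have "norm (T g) \<le> \<epsilon> * norm g" by (rule small) (simp add: g_def inner_diff_left vB)
    moreover have "\<bar>c\<bar> * norm g \<le> norm (T g) + norm (T g - c *\<^sub>R g)"
      using norm_triangle_ineq4[of "T g" "T g - c *\<^sub>R g"] by simp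
    moreover have "h n - h m = T g - c *\<^sub>R g" by (simp add: h_def g_def T.diff algebra_simps)
    ultimately show ?thesis by (simp add: \<epsilon>_def g_def)
  qed
  have "Cauchy v"
  proof (rule metric_CauchyI)
    fix e :: real assume "e > 0"
    hence "\<epsilon> * e > 0" using \<epsilon> by simp
    from metric_CauchyD[OF hC this] obtain M where "\<forall>m\<ge>M. \<forall>n\<ge>M. dist (h m) (h n) < \<epsilon> * e" by auto
    hence "\<forall>m\<ge>M. \<forall>n\<ge>M. \<epsilon> * dist (v m) (v n) < \<epsilon> * e" using est by (metis dist_norm le_less_trans)
    thus "\<exists>M. \<forall>m\<ge>M. \<forall>n\<ge>M. dist (v m) (v n) < e" using \<epsilon> by auto
  qed
  then obtain k where k: "v \<longlonglongrightarrow> k" using Cauchy_convergent convergent_def by blast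
  define l where "l = k + (\<Sum>b\<in>B. L b *\<^sub>R b)"
  have "(\<lambda>n. v n + u n) \<longlonglongrightarrow> l" unfolding l_def by (intro tendsto_add k u)
  hence l: "(\<lambda>n. f (r n)) \<longlonglongrightarrow> l" by (simp add: v_def)
  hence "(\<lambda>n. T (f (r n)) - c *\<^sub>R f (r n)) \<longlonglongrightarrow> T l - c *\<^sub>R l"
    by (intro tendsto_diff T.tendsto tendsto_scaleR tendsto_const)
  with lim' have "T l - c *\<^sub>R l = 0" by (rule LIMSEQ_unique[symmetric])
  with l r show ?thesis by (intro that[of r l]) (auto simp: o_def)
qed

lemma compact_op_approx_eigenvalue:
  fixes T :: "'a::{real_inner,complete_space} \<Rightarrow> 'a"
  assumes T: "bounded_linear T" "compact_op T" and c: "c \<noteq> 0" and M: "closed M"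
    and f: "\<And>n. f n \<in> M" "\<And>n. norm (f n) = 1" and lim: "(\<lambda>n. T (f n) - c *\<^sub>R f n) \<longlonglongrightarrow> 0"
  shows "\<exists>g\<in>M. norm g = 1 \<and> T g = c *\<^sub>R g"
proof -
  obtain r l where r: "strict_mono r" "(f \<circ> r) \<longlonglongrightarrow> l" "T l = c *\<^sub>R l"
    using compact_op_approx_eigenvectors[OF T c _ lim, of 1] f by auto
  have "l \<in> M" using closed_sequentially[OF M _ r(2)] f by auto
  moreover have "norm l = 1"
    using LIMSEQ_unique[OF tendsto_norm[OF r(2)], of 1] f(2) by (simp add: o_def)
  ultimately show ?thesis using r by blast
qed

text \<open>
  Otherwise a subsequence of the eigenvalues, which are bounded by the norm of \<open>T\<close>, converges to
  some \<open>l \<noteq> 0\<close>, the eigenvectors become approximate eigenvectors for \<open>l\<close>, and a further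
  subsequence of them converges. But distinct orthonormal vectors have distance \<open>sqrt 2\<close>.
\<close>

lemma orthonormal_eigenvectors_finite:
  fixes T :: "'a::{real_inner,complete_space} \<Rightarrow> 'a"
  assumes T: "bounded_linear T" "compact_op T" and S: "orthonormal S" and d: "d > 0"
    and ev: "\<And>s. s \<in> S \<Longrightarrow> \<exists>c. \<bar>c\<bar> \<ge> d \<and> T s = c *\<^sub>R s"
  shows "finite S"
proof (rule ccontr)
  assume "infinite S"
  then obtain s :: "nat \<Rightarrow> 'a" where s: "inj s" "range s \<subseteq> S" using infinite_countable_subset by blast
  interpret T: bounded_linear T by fact
  have n1: "norm (s n) = 1" for n using S s by (auto simp: orthonormal_def)
  have "\<forall>n. \<exists>c. \<bar>c\<bar> \<ge> d \<and> T (s n) = c *\<^sub>R s n" using ev s by blast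
  then obtain c where c: "\<And>n. \<bar>c n\<bar> \<ge> d" "\<And>n. T (s n) = c n *\<^sub>R s n" by metis
  obtain K where K: "\<And>x. norm (T x) \<le> norm x * K" using T.bounded by auto
  have "bounded (range c)"
    by (rule boundedI[where B = K]) (use K[of "s _"] in \<open>auto simp: c n1\<close>)
  then obtain l q where q: "strict_mono (q :: nat \<Rightarrow> nat)" "(c \<circ> q) \<longlonglongrightarrow> l"
    using bounded_imp_convergent_subsequence by blast
  have "d \<le> \<bar>l\<bar>" using tendsto_rabs[OF q(2)] c(1) by (intro LIMSEQ_le_const) auto
  hence l0: "l \<noteq> 0" using d by auto
  have "(\<lambda>n. \<bar>c (q n) - l\<bar>) \<longlonglongrightarrow> 0"
    using q(2) by (simp add: o_def tendsto_rabs_zero_iff LIM_zero_iff)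
  hence lim: "(\<lambda>n. T (s (q n)) - l *\<^sub>R s (q n)) \<longlonglongrightarrow> 0"
    by (rule tendsto_norm_zero_cancel[OF Lim_transform_eventually])
       (simp add: c n1 flip: scaleR_diff_left)
  obtain r k where r: "strict_mono (r :: nat \<Rightarrow> nat)" "((\<lambda>n. s (q n)) \<circ> r) \<longlonglongrightarrow> k"
    using compact_op_approx_eigenvectors[OF T l0 _ lim, of 1] n1 by (metis order_refl)
  have "Cauchy (\<lambda>n. s (q (r n)))" using r(2) by (simp add: o_def LIMSEQ_imp_Cauchy)
  from metric_CauchyD[OF this, of 1] obtain N where
    "\<And>m n. m \<ge> N \<Longrightarrow> n \<ge> N \<Longrightarrow> dist (s (q (r m))) (s (q (r n))) < 1" by auto
  hence D: "dist (s (q (r N))) (s (q (r (Suc N)))) < 1" by auto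
  let ?x = "s (q (r N))" and ?y = "s (q (r (Suc N)))"
  have "q (r N) \<noteq> q (r (Suc N))" using q(1) r(1) by (simp add: strict_mono_eq)
  hence ne: "?x \<noteq> ?y" using s(1) by (auto dest: injD)
  have "?x \<bullet> ?y = 0" "?x \<bullet> ?x = 1" "?y \<bullet> ?y = 1"
    using orthonormal_inner[OF S] ne range_subsetD[OF s(2)] by simp_all
  hence "(dist ?x ?y)\<^sup>2 = 2"
    by (simp add: dist_norm power2_norm_eq_inner inner_diff_left inner_diff_right inner_commute)
  moreover have "(dist ?x ?y)\<^sup>2 < 1" using D by (simp add: power_less_one_iff)
  ultimately show False by simp
qed

lemma selfadjoint_eigenvectors_orthogonal:
  assumes "selfadjoint T" "T f = c *\<^sub>R f" "T g = d *\<^sub>R g" "c \<noteq> d"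
  shows "f \<bullet> g = 0"
proof -
  have "c * (f \<bullet> g) = d * (f \<bullet> g)" using assms unfolding selfadjoint_def by (metis inner_scaleR_left inner_scaleR_right)
  thus ?thesis using assms(4) by simp
qed

text \<open>
  Unit eigenvectors of distinct eigenvalues form an orthonormal set.
\<close>

lemma compact_selfadjoint_eigenvalues_discrete:
  fixes T :: "'a::{real_inner,complete_space} \<Rightarrow> 'a"
  assumes T: "bounded_linear T" "compact_op T" and sa: "selfadjoint T" and d: "d > 0"
  shows "finite {c. \<bar>c\<bar> \<ge> d \<and> (\<exists>f. f \<noteq> 0 \<and> T f = c *\<^sub>R f)}"
proof -
  interpret T: bounded_linear T by fact
  define E where "E = {c. \<bar>c\<bar> \<ge> d \<and> (\<exists>f. f \<noteq> 0 \<and> T f = c *\<^sub>R f)}"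
  have "\<exists>f. norm f = 1 \<and> T f = c *\<^sub>R f" if "c \<in> E" for c
  proof -
    from that obtain f where "f \<noteq> 0" "T f = c *\<^sub>R f" by (auto simp: E_def)
    thus ?thesis by (intro exI[of _ "f /\<^sub>R norm f"]) (auto simp: T.scaleR)
  qed
  then obtain e where e: "\<And>c. c \<in> E \<Longrightarrow> norm (e c) = 1" "\<And>c. c \<in> E \<Longrightarrow> T (e c) = c *\<^sub>R e c" by metis
  have orth: "e c \<bullet> e c' = 0" if "c \<in> E" "c' \<in> E" "c \<noteq> c'" for c c'
    using selfadjoint_eigenvectors_orthogonal[OF sa e(2) e(2)] that by blast
  have "orthonormal (e ` E)"
    unfolding orthonormal_def pairwise_def orthogonal_def using orth e(1) by (metis imageE)
  hence "finite (e ` E)"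
    by (rule orthonormal_eigenvectors_finite[OF T _ d]) (use e(2) in \<open>auto simp: E_def\<close>)
  moreover have "inj_on e E"
  proof (rule inj_onI)
    fix c c' assume *: "c \<in> E" "c' \<in> E" "e c = e c'"
    have "e c \<bullet> e c' \<noteq> 0" using e(1)[OF *(1)] *(3) by auto
    thus "c = c'" using orth[OF *(1,2)] by blast
  qed
  ultimately show ?thesis unfolding E_def by (rule finite_imageD)
qed

text \<open>
  A maximal orthonormal subset of the eigenspace is finite, and by maximality it spans.
\<close>

lemma compact_op_eigenspace_finite_dim:
  fixes T :: "'a::{real_inner,complete_space} \<Rightarrow> 'a"
  assumes T: "bounded_linear T" "compact_op T" and c: "c \<noteq> 0"
  obtains B where "finite B" "B \<subseteq> {f. T f = c *\<^sub>R f}"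
    "\<And>f. T f = c *\<^sub>R f \<Longrightarrow> f = (\<Sum>b\<in>B. (f \<bullet> b) *\<^sub>R b)"
proof -
  interpret T: bounded_linear T by fact
  let ?W = "{f. T f = c *\<^sub>R f}"
  obtain B where B: "B \<subseteq> ?W" "orthonormal B"
    and mx: "\<And>a. a \<in> ?W \<Longrightarrow> norm a = 1 \<Longrightarrow> \<exists>s\<in>B. a \<bullet> s \<noteq> 0"
    using maximal_orthonormal_subset by blast
  have fin: "finite B"
    by (rule orthonormal_eigenvectors_finite[OF T B(2), of "\<bar>c\<bar>"]) (use c B(1) in auto)
  have "f = (\<Sum>b\<in>B. (f \<bullet> b) *\<^sub>R b)" if f: "T f = c *\<^sub>R f" for f
  proof (rule ccontr)
    define g where "g = f - (\<Sum>b\<in>B. (f \<bullet> b) *\<^sub>R b)"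
    assume "\<not> ?thesis"
    hence "g \<noteq> 0" by (simp add: g_def)
    moreover have Tg: "T g = c *\<^sub>R g"
    proof -
      have "T b = c *\<^sub>R b" if "b \<in> B" for b using B that by auto
      thus ?thesis unfolding g_def
        by (simp add: T.diff T.sum T.scaleR f scaleR_diff_right scaleR_sum_right mult.commute)
    qed
    ultimately obtain s where "s \<in> B" "(g /\<^sub>R norm g) \<bullet> s \<noteq> 0"
      using mx[of "g /\<^sub>R norm g"] by (auto simp: T.scaleR)
    thus False using orthonormal_remainder[OF B(2) fin, of s f] by (simp add: g_def)
  qed
  thus ?thesis using that fin B(1) by blast
qed

text \<open>
  Since \<open>T\<^sup>2\<close> is coercive, \<open>T\<^sup>2 x = g\<close> is solved by the fixed point of the relaxation step
  \<open>x \<mapsto> x - t (T\<^sup>2 x - g)\<close>, which is a contraction for small \<open>t > 0\<close>. This avoids orthogonal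
  projections onto the range.
\<close>

lemma selfadjoint_bounded_below_surj:
  fixes T :: "'a::{real_inner,complete_space} \<Rightarrow> 'a"
  assumes T: "bounded_linear T" "selfadjoint T" and C: "\<And>f. norm f \<le> C * norm (T f)"
  shows "surj T"
proof -
  interpret T: bounded_linear T by fact
  obtain K where K: "K > 0" "\<And>x. norm (T x) \<le> norm x * K" using T.pos_bounded by auto
  define D where "D = \<bar>C\<bar> + 1"
  have D: "D > 0" "norm f \<le> D * norm (T f)" for f
  proof -
    show "D > 0" by (simp add: D_def)
    have "C * norm (T f) \<le> D * norm (T f)" by (rule mult_right_mono) (auto simp: D_def)
    thus "norm f \<le> D * norm (T f)" using C[of f] by simp
  qed
  define a where "a = 1 / D\<^sup>2"
  \<comment> \<open>the maximum with \<open>a\<^sup>2\<close> only ensures \<open>t * a \<le> 1\<close>, so that the square root below is real\<close>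
  define b where "b = max (K ^ 4) (a\<^sup>2)"
  define t where "t = a / b"
  have a: "a > 0" using D(1) by (simp add: a_def)
  have b: "b > 0" "K ^ 4 \<le> b" "a\<^sup>2 \<le> b" using a by (auto simp: b_def less_max_iff_disj)
  have t: "t > 0" using a b by (auto simp: t_def)
  have coercive: "a * (norm f)\<^sup>2 \<le> (norm (T f))\<^sup>2" for f
  proof -
    have "(norm f)\<^sup>2 \<le> (D * norm (T f))\<^sup>2" using D(2) by (intro power_mono) auto
    thus ?thesis using D(1) by (simp add: a_def field_simps power_mult_distrib)
  qed
  have bounded: "(norm (T (T f)))\<^sup>2 \<le> b * (norm f)\<^sup>2" for f
  proof -
    have "norm (T (T f)) \<le> norm f * K * K"
      using K(2)[of "T f"] K(1) mult_right_mono[OF K(2)[of f], of K] by linarith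
    hence "(norm (T (T f)))\<^sup>2 \<le> (norm f * K * K)\<^sup>2" by (intro power_mono) auto
    also have "\<dots> = K ^ 4 * (norm f)\<^sup>2" by (simp add: power_mult_distrib power4_eq_xxxx power2_eq_square)
    also have "\<dots> \<le> b * (norm f)\<^sup>2" using b by (intro mult_right_mono) auto
    finally show ?thesis .
  qed
  have contr: "(norm (f - t *\<^sub>R T (T f)))\<^sup>2 \<le> (1 - t * a) * (norm f)\<^sup>2" for f
  proof -
    have "(norm (f - t *\<^sub>R T (T f)))\<^sup>2
        = (norm f)\<^sup>2 - 2 * t * (norm (T f))\<^sup>2 + t\<^sup>2 * (norm (T (T f)))\<^sup>2"
    proof -
      have "f \<bullet> T (T f) = T f \<bullet> T f" using T(2) by (simp add: selfadjoint_def)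
      thus ?thesis
        using dot_norm_neg[of f "t *\<^sub>R T (T f)"]
        by (simp add: power2_norm_eq_inner[of "T f"] power_mult_distrib)
    qed
    also have "\<dots> \<le> (norm f)\<^sup>2 - 2 * t * (a * (norm f)\<^sup>2) + t\<^sup>2 * (b * (norm f)\<^sup>2)"
      using t coercive[of f] bounded[of f] by (intro add_mono diff_mono mult_left_mono) auto
    also have "t\<^sup>2 * (b * (norm f)\<^sup>2) = t * a * (norm f)\<^sup>2"
      using b by (simp add: t_def power2_eq_square)
    finally show ?thesis by (simp add: algebra_simps)
  qed
  define q where "q = sqrt (1 - t * a)"
  have "0 < t * a" "t * a \<le> 1" using a b t by (auto simp: t_def field_simps power2_eq_square)
  hence q: "0 \<le> q" "q < 1" by (auto simp: q_def)
  have contr': "norm (f - t *\<^sub>R T (T f)) \<le> q * norm f" for f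
    using real_sqrt_le_mono[OF contr[of f]] by (simp add: q_def real_sqrt_mult)
  have "\<exists>x. T x = g" for g
  proof -
    have "\<exists>!x. x - t *\<^sub>R T (T x) + t *\<^sub>R g = x"
    proof (rule banach_fix_type[OF q], intro allI)
      fix x y
      have "(x - t *\<^sub>R T (T x) + t *\<^sub>R g) - (y - t *\<^sub>R T (T y) + t *\<^sub>R g)
          = (x - y) - t *\<^sub>R T (T (x - y))" by (simp add: T.diff algebra_simps)
      thus "dist (x - t *\<^sub>R T (T x) + t *\<^sub>R g) (y - t *\<^sub>R T (T y) + t *\<^sub>R g) \<le> q * dist x y"
        unfolding dist_norm using contr'[of "x - y"] by (simp only:)
    qed
    then obtain x where "x - t *\<^sub>R T (T x) + t *\<^sub>R g = x" by auto
    hence "T (T x) = g" using t by (auto simp: algebra_simps)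
    thus ?thesis by blast
  qed
  thus ?thesis by (metis surjI)
qed

text \<open>
  The Fredholm alternative. If \<open>c - T\<close> were not bounded below, unit vectors \<open>g n\<close> with
  \<open>(T - c) g n \<longlonglongrightarrow> 0\<close> would accumulate at a unit eigenvector; surjectivity follows by
  self-adjointness.
\<close>

lemma compact_selfadjoint_fredholm:
  fixes T :: "'a::{real_inner,complete_space} \<Rightarrow> 'a"
  assumes T: "bounded_linear T" "compact_op T" and sa: "selfadjoint T" and c: "c \<noteq> 0"
    and inj: "\<And>f. T f = c *\<^sub>R f \<Longrightarrow> f = 0"
  shows "\<exists>C. \<forall>f. norm f \<le> C * norm (c *\<^sub>R f - T f)" "surj (\<lambda>f. c *\<^sub>R f - T f)"
proof -
  interpret T: bounded_linear T by fact
  show bb: "\<exists>C. \<forall>f. norm f \<le> C * norm (c *\<^sub>R f - T f)"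
  proof (rule ccontr)
    assume "\<not> ?thesis"
    hence "\<not> (\<exists>C. \<forall>f. norm f \<le> C * norm (T f - c *\<^sub>R f))"
      by (simp add: norm_minus_commute)
    hence "\<forall>n::nat. \<exists>f. \<not> norm f \<le> real (Suc n) * norm (T f - c *\<^sub>R f)" by blast
    then obtain f where f: "\<And>n::nat. norm (f n) > real (Suc n) * norm (T (f n) - c *\<^sub>R f n)"
      by (metis not_le)
    have nz: "norm (f n) > 0" for n
      using f[of n] mult_nonneg_nonneg[of "real (Suc n)" "norm (T (f n) - c *\<^sub>R f n)"] by (smt (verit) norm_ge_zero of_nat_0_le_iff)
    define g where "g n = f n /\<^sub>R norm (f n)" for n
    have "norm (T (g n) - c *\<^sub>R g n) \<le> 1 / real (Suc n)" for n
    proof -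
      have "T (g n) - c *\<^sub>R g n = (T (f n) - c *\<^sub>R f n) /\<^sub>R norm (f n)"
        by (simp add: g_def T.scaleR algebra_simps)
      hence "norm (T (g n) - c *\<^sub>R g n) = norm (T (f n) - c *\<^sub>R f n) / norm (f n)"
        by (simp add: divide_inverse_commute)
      also have "\<dots> \<le> 1 / real (Suc n)"
        using f[of n] nz[of n] by (simp add: divide_simps) (simp add: algebra_simps)
      finally show ?thesis .
    qed
    hence "(\<lambda>n. T (g n) - c *\<^sub>R g n) \<longlonglongrightarrow> 0"
      by (intro Lim_null_comparison[OF _ LIMSEQ_Suc[OF lim_1_over_n]]) auto
    moreover have "norm (g n) = 1" for n using nz[of n] by (simp add: g_def)
    ultimately obtain l where "norm l = 1" "T l = c *\<^sub>R l"
      using compact_op_approx_eigenvalue[OF T c closed_UNIV, of g] by auto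
    thus False using inj[of l] by auto
  qed
  then obtain C where C: "\<And>f. norm f \<le> C * norm (c *\<^sub>R f - T f)" by blast
  show "surj (\<lambda>f. c *\<^sub>R f - T f)"
  proof (rule selfadjoint_bounded_below_surj[OF _ _ C])
    show "bounded_linear (\<lambda>f. c *\<^sub>R f - T f)"
      by (intro bounded_linear_sub T bounded_linear_scaleR_right)
    show "selfadjoint (\<lambda>f. c *\<^sub>R f - T f)"
      using sa by (simp add: selfadjoint_def inner_diff_left inner_diff_right)
  qed
qed

text \<open>
  Let \<open>m\<close> be the norm of \<open>T\<close> on \<open>M\<close>, positive without loss of generality. A sequence of unit vectors in \<open>M\<close> whose images have norm
  tending to \<open>m\<close> consists of approximate eigenvectors of \<open>T\<^sup>2\<close> for \<open>m\<^sup>2\<close>, and so \<open>T\<^sup>2\<close> has a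
  unit eigenvector \<open>g\<close> in \<open>M\<close> for \<open>m\<^sup>2\<close>. Because \<open>(T - m) (T + m) g = 0\<close>, either \<open>g\<close> itself
  or \<open>T g + m g\<close> is an eigenvector of \<open>T\<close>.
\<close>

lemma compact_selfadjoint_has_eigenvector:
  fixes T :: "'a::{real_inner,complete_space} \<Rightarrow> 'a"
  assumes T: "bounded_linear T" "compact_op T" and sa: "selfadjoint T"
    and M: "subspace M" "closed M" "\<And>f. f \<in> M \<Longrightarrow> T f \<in> M" and f0: "f0 \<in> M" "f0 \<noteq> 0"
  shows "\<exists>e\<in>M. \<exists>c. norm e = 1 \<and> T e = c *\<^sub>R e"
proof -
  interpret T: bounded_linear T by fact
  define U where "U = {f\<in>M. norm f = 1}"
  obtain K where K: "K > 0" "\<And>x. norm (T x) \<le> norm x * K" using T.pos_bounded by auto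
  have ne: "f0 /\<^sub>R norm f0 \<in> U" using f0 M(1) by (auto simp: U_def subspace_scale)
  have bdd: "bdd_above ((\<lambda>f. norm (T f)) ` U)"
  proof (rule bdd_aboveI2[where M = K])
    fix f assume "f \<in> U"
    thus "norm (T f) \<le> K" using K(2)[of f] by (simp add: U_def)
  qed
  define m where "m = (SUP f\<in>U. norm (T f))"
  have le1: "norm (T f) \<le> m" if "f \<in> U" for f
    unfolding m_def using that bdd by (rule cSUP_upper)
  have m0: "m \<ge> 0" using le1[OF ne] norm_ge_zero order_trans by blast
  have le: "norm (T f) \<le> m * norm f" if "f \<in> M" for f
  proof (cases "f = 0")
    case True thus ?thesis by (simp add: T.zero)
  next
    case False
    hence "norm (T (f /\<^sub>R norm f)) \<le> m" using that M(1) by (intro le1) (auto simp: U_def subspace_scale)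
    thus ?thesis using False by (simp add: T.scaleR field_simps)
  qed
  show ?thesis
  proof (cases "m = 0")
    case True
    have "T (f0 /\<^sub>R norm f0) = 0 *\<^sub>R (f0 /\<^sub>R norm f0)"
      using le1[OF ne] True by simp
    thus ?thesis using ne unfolding U_def by blast
  next
    case False
    hence m: "m > 0" using m0 by simp
    have "\<exists>f\<in>U. m - 1 / real (Suc n) < norm (T f)" for n
      using less_cSUP_iff[OF _ bdd, of "m - 1 / real (Suc n)"] ne by (auto simp: m_def[symmetric])
    then obtain f where f: "\<And>n. f n \<in> U" "\<And>n. m - 1 / real (Suc n) < norm (T (f n))" by metis
    have lim1: "(\<lambda>n. norm (T (f n))) \<longlonglongrightarrow> m"
    proof (rule tendsto_sandwich)
      show "(\<lambda>n. m - 1 / real (Suc n)) \<longlonglongrightarrow> m"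
        using tendsto_diff[OF tendsto_const LIMSEQ_Suc[OF lim_1_over_n]] by (metis diff_zero)
      show "(\<lambda>n. m) \<longlonglongrightarrow> m" by simp
      show "\<forall>\<^sub>F n in sequentially. m - 1 / real (Suc n) \<le> norm (T (f n))"
        using f(2) by (intro always_eventually allI less_imp_le)
      show "\<forall>\<^sub>F n in sequentially. norm (T (f n)) \<le> m"
        using le1[OF f(1)] by simp
    qed
    have est: "(norm (T (T (f n)) - m\<^sup>2 *\<^sub>R f n))\<^sup>2 \<le> m\<^sup>2 * (m\<^sup>2 - (norm (T (f n)))\<^sup>2)" for n
    proof -
      have fn: "f n \<in> M" "norm (f n) = 1" using f(1) by (auto simp: U_def)
      have "norm (T (T (f n))) \<le> m * norm (T (f n))" using fn M(3) by (intro le) auto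
      hence 1: "(norm (T (T (f n))))\<^sup>2 \<le> (m * norm (T (f n)))\<^sup>2" by (rule power_mono) simp
      have 2: "T (T (f n)) \<bullet> f n = T (f n) \<bullet> T (f n)" using sa by (simp add: selfadjoint_def)
      have "(norm (T (T (f n)) - m\<^sup>2 *\<^sub>R f n))\<^sup>2
          = (norm (T (T (f n))))\<^sup>2 - 2 * m\<^sup>2 * (norm (T (f n)))\<^sup>2 + m\<^sup>2 * m\<^sup>2"
        using dot_norm_neg[of "T (T (f n))" "m\<^sup>2 *\<^sub>R f n"] fn(2)
        by (simp add: 2 power2_norm_eq_inner[of "T (f n)"] power2_eq_square[of "m\<^sup>2"])
      with 1 show ?thesis by (simp add: power_mult_distrib algebra_simps)
    qed
    have "(\<lambda>n. m\<^sup>2 * (m\<^sup>2 - (norm (T (f n)))\<^sup>2)) \<longlonglongrightarrow> m\<^sup>2 * (m\<^sup>2 - m\<^sup>2)"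
      by (intro tendsto_intros lim1)
    hence lim0: "(\<lambda>n. m\<^sup>2 * (m\<^sup>2 - (norm (T (f n)))\<^sup>2)) \<longlonglongrightarrow> 0" by simp
    have "(\<lambda>n. (norm (T (T (f n)) - m\<^sup>2 *\<^sub>R f n))\<^sup>2) \<longlonglongrightarrow> 0"
      by (rule Lim_null_comparison[OF always_eventually lim0]) (use est in simp)
    from tendsto_real_sqrt[OF this]
    have "(\<lambda>n. norm (T (T (f n)) - m\<^sup>2 *\<^sub>R f n)) \<longlonglongrightarrow> 0" by simp
    hence lim2: "(\<lambda>n. (T \<circ> T) (f n) - m\<^sup>2 *\<^sub>R f n) \<longlonglongrightarrow> 0"
      by (simp add: tendsto_norm_zero_iff)
    have cT: "compact_op (T \<circ> T)" unfolding compact_op_def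
    proof (intro allI impI)
      fix \<epsilon> :: real assume "\<epsilon> > 0"
      hence "\<epsilon> / K > 0" using K by simp
      then obtain B where B: "finite B" "orthonormal B"
        "\<And>f. (\<And>b. b \<in> B \<Longrightarrow> f \<bullet> b = 0) \<Longrightarrow> norm (T f) \<le> \<epsilon> / K * norm f"
        using T(2) unfolding compact_op_def by metis
      have "norm ((T \<circ> T) f) \<le> \<epsilon> * norm f" if "\<forall>b\<in>B. f \<bullet> b = 0" for f
        using K(2)[of "T f"] K(1) B(3)[of f] that by (auto simp: field_simps intro: order_trans)
      thus "\<exists>B. finite B \<and> orthonormal B \<and> (\<forall>f. (\<forall>b\<in>B. f \<bullet> b = 0) \<longrightarrow> norm ((T \<circ> T) f) \<le> \<epsilon> * norm f)"
        using B(1,2) by blast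
    qed
    have "bounded_linear (T \<circ> T)" using bounded_linear_compose[OF T(1) T(1)] by (simp add: o_def)
    from compact_op_approx_eigenvalue[OF this cT _ M(2) _ _ lim2] m f(1)
    obtain g where g: "g \<in> M" "norm g = 1" "T (T g) = m\<^sup>2 *\<^sub>R g"
      by (auto simp: U_def)
    define h where "h = T g + m *\<^sub>R g"
    show ?thesis
    proof (cases "h = 0")
      case True
      hence "T g = (- m) *\<^sub>R g" by (simp add: h_def eq_neg_iff_add_eq_0)
      thus ?thesis using g by blast
    next
      case False
      have "T h = m *\<^sub>R h" by (simp add: h_def T.add T.scaleR g(3) algebra_simps power2_eq_square)
      moreover have "h \<in> M" using g(1) M(1,3) by (auto simp: h_def intro: subspace_add subspace_scale)
      ultimately have "h /\<^sub>R norm h \<in> M" "norm (h /\<^sub>R norm h) = 1"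
          "T (h /\<^sub>R norm h) = m *\<^sub>R (h /\<^sub>R norm h)"
        using False M(1) by (auto simp: T.scaleR subspace_scale)
      thus ?thesis by blast
    qed
  qed
qed

text \<open>
  The spectral theorem: the orthogonal complement of a maximal orthonormal set of eigenvectors is
  closed and invariant, so it would contain another eigenvector if it were not zero.
\<close>

lemma compact_selfadjoint_eigenbasis:
  fixes T :: "'a::{real_inner,complete_space} \<Rightarrow> 'a"
  assumes T: "bounded_linear T" "compact_op T" and sa: "selfadjoint T"
  obtains S where "orthonormal S" "\<And>s. s \<in> S \<Longrightarrow> \<exists>c. T s = c *\<^sub>R s"
    "\<And>f. (\<And>s. s \<in> S \<Longrightarrow> f \<bullet> s = 0) \<Longrightarrow> f = 0"
proof -
  obtain S where S: "S \<subseteq> {e. \<exists>c. T e = c *\<^sub>R e}" "orthonormal S"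
    and mx: "\<And>a. a \<in> {e. \<exists>c. T e = c *\<^sub>R e} \<Longrightarrow> norm a = 1 \<Longrightarrow> \<exists>s\<in>S. a \<bullet> s \<noteq> 0"
    using maximal_orthonormal_subset by blast
  define M where "M = {f. \<forall>s\<in>S. f \<bullet> s = 0}"
  have sub: "subspace M" by (auto simp: subspace_def M_def inner_add_left)
  have "M = (\<Inter>s\<in>S. {f. f \<bullet> s = 0})" by (auto simp: M_def)
  hence cl: "closed M" by (auto intro!: closed_INT closed_Collect_eq continuous_intros)
  have inv: "T f \<in> M" if "f \<in> M" for f
  proof -
    have "T f \<bullet> s = 0" if s: "s \<in> S" for s
    proof -
      obtain c where "T s = c *\<^sub>R s" using S s by auto
      thus ?thesis using sa \<open>f \<in> M\<close> s by (simp add: selfadjoint_def M_def)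
    qed
    thus ?thesis by (simp add: M_def)
  qed
  have "f = 0" if "\<And>s. s \<in> S \<Longrightarrow> f \<bullet> s = 0" for f
  proof (rule ccontr)
    assume "f \<noteq> 0"
    moreover have "f \<in> M" using that by (simp add: M_def)
    ultimately obtain e c where "e \<in> M" "norm e = 1" "T e = c *\<^sub>R e"
      using compact_selfadjoint_has_eigenvector[OF T sa sub cl inv] by blast
    thus False using mx[of e] by (auto simp: M_def)
  qed
  thus ?thesis using that S by blast
qed

text \<open>
  In infinite dimension an orthonormal eigenbasis is infinite, whereas only finitely many of its
  members have an eigenvalue of modulus at least \<open>d\<close>. That the dimension is infinite is expressed by
  the infinite orthonormal set \<open>E\<close>.
\<close>

lemma compact_selfadjoint_small_eigenvectors:
  fixes T :: "'a::{real_inner,complete_space} \<Rightarrow> 'a"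
  assumes T: "bounded_linear T" "compact_op T" and sa: "selfadjoint T" and d: "d > 0"
    and E: "infinite E" "orthonormal (E :: 'a set)"
  obtains S where "infinite S" "orthonormal S" "\<And>s. s \<in> S \<Longrightarrow> \<exists>c. \<bar>c\<bar> < d \<and> T s = c *\<^sub>R s"
proof -
  obtain S where S: "orthonormal S" "\<And>s. s \<in> S \<Longrightarrow> \<exists>c. T s = c *\<^sub>R s"
    and tot: "\<And>f. (\<And>s. s \<in> S \<Longrightarrow> f \<bullet> s = 0) \<Longrightarrow> f = 0"
    using compact_selfadjoint_eigenbasis[OF T sa] by blast
  have infS: "infinite S"
  proof
    assume fin: "finite S"
    have "f \<in> span S" for f
    proof -
      have "f - (\<Sum>t\<in>S. (f \<bullet> t) *\<^sub>R t) = 0"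
        by (rule tot) (rule orthonormal_remainder[OF S(1) fin])
      hence "f = (\<Sum>t\<in>S. (f \<bullet> t) *\<^sub>R t)" by simp
      also have "\<dots> \<in> span S" by (intro span_sum span_scale span_base)
      finally show ?thesis .
    qed
    hence "finite E"
      using independent_span_bound[OF fin orthonormal_independent[OF E(2)]] by blast
    thus False using E(1) by simp
  qed
  define L where "L = {s\<in>S. \<exists>c. \<bar>c\<bar> \<ge> d \<and> T s = c *\<^sub>R s}"
  have "finite L"
    by (rule orthonormal_eigenvectors_finite[OF T _ d])
       (use orthonormal_mono[OF S(1)] in \<open>auto simp: L_def\<close>)
  hence "infinite (S - L)" using infS by simp
  moreover have "orthonormal (S - L)" using S(1) by (rule orthonormal_mono) auto
  moreover have "\<exists>c. \<bar>c\<bar> < d \<and> T s = c *\<^sub>R s" if "s \<in> S - L" for s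
    using S(2)[of s] that by (auto simp: L_def not_le)
  ultimately show ?thesis using that by blast
qed

section \<open>The Hilbert space of square-summable functions\<close>

text \<open>
  The unweighted space of square-summable functions. As a type it is an instance of the Hilbert
  space classes, which the weighted space \<open>l2 w\<close>, a set depending on the term \<open>w\<close>, cannot be.
\<close>

typedef 'v ell2 = "{f :: 'v \<Rightarrow> real. (\<lambda>x. (f x)\<^sup>2) summable_on UNIV}"
  morphisms coord ell2_of by (rule exI[of _ "\<lambda>_. 0"]) simp

setup_lifting type_definition_ell2

lemma square_summable_mult:
  fixes f g :: "'v \<Rightarrow> real"
  assumes "(\<lambda>x. (f x)\<^sup>2) summable_on UNIV" "(\<lambda>x. (g x)\<^sup>2) summable_on UNIV"
  shows "(\<lambda>x. f x * g x) summable_on UNIV"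
proof -
  have "(\<lambda>x. (f x)\<^sup>2 + (g x)\<^sup>2) summable_on UNIV" using assms by (rule summable_on_add)
  moreover have "norm (f x * g x) \<le> (f x)\<^sup>2 + (g x)\<^sup>2" for x
  proof -
    have "2 * \<bar>f x\<bar> * \<bar>g x\<bar> \<le> (f x)\<^sup>2 + (g x)\<^sup>2" using sum_squares_bound[of "\<bar>f x\<bar>" "\<bar>g x\<bar>"] by simp
    moreover have "0 \<le> \<bar>f x\<bar> * \<bar>g x\<bar>" by simp
    ultimately have "\<bar>f x\<bar> * \<bar>g x\<bar> \<le> (f x)\<^sup>2 + (g x)\<^sup>2" by linarith
    thus ?thesis by (simp add: abs_mult)
  qed
  ultimately have "(\<lambda>x. norm (f x * g x)) summable_on UNIV"
    by (rule summable_on_comparison_test) auto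
  thus ?thesis by (rule abs_summable_summable)
qed

lemma square_summable_add:
  fixes f g :: "'v \<Rightarrow> real"
  assumes f: "(\<lambda>x. (f x)\<^sup>2) summable_on UNIV" and g: "(\<lambda>x. (g x)\<^sup>2) summable_on UNIV"
  shows "(\<lambda>x. (f x + g x)\<^sup>2) summable_on UNIV"
proof -
  have "(\<lambda>x. (f x)\<^sup>2 + (g x)\<^sup>2 + 2 * (f x * g x)) summable_on UNIV"
    by (intro summable_on_add f g summable_on_cmult_right square_summable_mult)
  thus ?thesis by (simp add: power2_sum algebra_simps)
qed

lemma square_summable_cmult:
  fixes f :: "'v \<Rightarrow> real"
  assumes "(\<lambda>x. (f x)\<^sup>2) summable_on UNIV"
  shows "(\<lambda>x. (c * f x)\<^sup>2) summable_on UNIV"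
  using summable_on_cmult_right[OF assms, of "c\<^sup>2"] by (simp add: power_mult_distrib)

instantiation ell2 :: (type) real_inner
begin

lift_definition zero_ell2 :: "'a ell2" is "\<lambda>_. 0" by simp
lift_definition plus_ell2 :: "'a ell2 \<Rightarrow> 'a ell2 \<Rightarrow> 'a ell2" is "\<lambda>f g x. f x + g x"
  by (rule square_summable_add)
lift_definition uminus_ell2 :: "'a ell2 \<Rightarrow> 'a ell2" is "\<lambda>f x. - f x" by simp
lift_definition minus_ell2 :: "'a ell2 \<Rightarrow> 'a ell2 \<Rightarrow> 'a ell2" is "\<lambda>f g x. f x - g x"
  using square_summable_add[of _ "\<lambda>x. - g x" for g] by simp
lift_definition scaleR_ell2 :: "real \<Rightarrow> 'a ell2 \<Rightarrow> 'a ell2" is "\<lambda>c f x. c * f x"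
  by (rule square_summable_cmult)
lift_definition inner_ell2 :: "'a ell2 \<Rightarrow> 'a ell2 \<Rightarrow> real" is "\<lambda>f g. \<Sum>\<^sub>\<infinity>x. f x * g x" .

definition "norm_ell2 f = sqrt (f \<bullet> f)" for f :: "'a ell2"
definition "dist_ell2 f g = norm (f - g)" for f g :: "'a ell2"
definition "sgn_ell2 (f :: 'a ell2) = scaleR (inverse (norm f)) f"
definition "(uniformity :: ('a ell2 \<times> 'a ell2) filter) = (INF e\<in>{0 <..}. principal {(x, y). dist x y < e})"
definition "open_ell2 S = (\<forall>x\<in>S. \<forall>\<^sub>F (x', y) in uniformity. x' = x \<longrightarrow> y \<in> S)" for S :: "'a ell2 set"

instance
proof
  fix f g h :: "'a ell2" and a b :: real
  show "f + g + h = f + (g + h)" "f + g = g + f" "0 + f = f" "- f + f = 0" "f - g = f + - g"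
    "a *\<^sub>R (f + g) = a *\<^sub>R f + a *\<^sub>R g" "(a + b) *\<^sub>R f = a *\<^sub>R f + b *\<^sub>R f"
    "a *\<^sub>R b *\<^sub>R f = (a * b) *\<^sub>R f" "1 *\<^sub>R f = f"
    by (transfer, simp add: algebra_simps)+
  show "sgn f = scaleR (inverse (norm f)) f" by (simp add: sgn_ell2_def)
  show "dist f g = norm (f - g)" by (simp add: dist_ell2_def)
  show "(uniformity :: ('a ell2 \<times> 'a ell2) filter) = (INF e\<in>{0 <..}. principal {(x, y). dist x y < e})"
    by (simp add: uniformity_ell2_def)
  show "open S = (\<forall>x\<in>S. \<forall>\<^sub>F (x', y) in uniformity. x' = x \<longrightarrow> y \<in> S)" for S :: "'a ell2 set"
    by (simp add: open_ell2_def)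
  show "f \<bullet> g = g \<bullet> f" by transfer (simp add: mult.commute)
  show "(f + g) \<bullet> h = f \<bullet> h + g \<bullet> h"
    by transfer (simp add: distrib_right infsum_add square_summable_mult)
  show "(a *\<^sub>R f) \<bullet> g = a * (f \<bullet> g)"
    by transfer (simp add: mult.assoc infsum_cmult_right')
  show "0 \<le> f \<bullet> f" by transfer (simp add: infsum_nonneg)
  show "f \<bullet> f = 0 \<longleftrightarrow> f = 0"
  proof transfer
    fix f :: "'a \<Rightarrow> real" assume f: "(\<lambda>x. (f x)\<^sup>2) summable_on UNIV"
    have "f x = 0" if "(\<Sum>\<^sub>\<infinity>x. f x * f x) = 0" for x
      using nonneg_infsum_le_0D[of "\<lambda>x. f x * f x" UNIV x] f that by (simp add: power2_eq_square)
    hence "f = (\<lambda>_. 0)" if "(\<Sum>\<^sub>\<infinity>x. f x * f x) = 0" using that by blast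
    moreover have "(\<Sum>\<^sub>\<infinity>x. f x * f x) = 0" if "f = (\<lambda>_. 0)" using that by simp
    ultimately show "((\<Sum>\<^sub>\<infinity>x. f x * f x) = 0) = (f = (\<lambda>_. 0))" by blast
  qed
  show "norm f = sqrt (f \<bullet> f)" by (simp add: norm_ell2_def)
qed

end

lemma coord_simps [simp]:
  "coord (f + g) x = coord f x + coord g x" "coord (f - g) x = coord f x - coord g x"
  "coord (c *\<^sub>R f) x = c * coord f x" "coord 0 x = 0"
  by (transfer, simp)+

lemma coord_summable: "(\<lambda>x. (coord f x)\<^sup>2) summable_on UNIV" by transfer

lemma inner_ell2_eq: "f \<bullet> g = (\<Sum>\<^sub>\<infinity>x. coord f x * coord g x)" by transfer simp

lemma norm_ell2_squared: "(norm f)\<^sup>2 = (\<Sum>\<^sub>\<infinity>x. (coord f x)\<^sup>2)" for f :: "'v ell2"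
  unfolding power2_norm_eq_inner inner_ell2_eq by (simp add: power2_eq_square)

lemma coord_le_norm: "\<bar>coord f x\<bar> \<le> norm f"
proof (rule power2_le_imp_le)
  show "\<bar>coord f x\<bar>\<^sup>2 \<le> (norm f)\<^sup>2"
    using finite_sum_le_infsum[OF coord_summable[of f], of "{x}"] by (simp add: norm_ell2_squared)
qed simp

lemma ell2_of_bound:
  assumes "\<And>F. finite F \<Longrightarrow> (\<Sum>x\<in>F. (f x)\<^sup>2) \<le> C\<^sup>2" "0 \<le> C"
  shows "coord (ell2_of f) = f" "norm (ell2_of f) \<le> C"
proof -
  have s: "(\<lambda>x. (f x)\<^sup>2) summable_on UNIV"
    by (rule nonneg_bdd_above_summable_on) (auto intro!: bdd_aboveI assms)
  thus c: "coord (ell2_of f) = f" by (simp add: ell2_of_inverse)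
  have "(\<Sum>\<^sub>\<infinity>x. (f x)\<^sup>2) \<le> C\<^sup>2" using s assms(1) by (intro infsum_le_finite_sums) auto
  hence "(norm (ell2_of f))\<^sup>2 \<le> C\<^sup>2" by (simp add: norm_ell2_squared c)
  thus "norm (ell2_of f) \<le> C" using assms(2) by (rule power2_le_imp_le)
qed

text \<open>
  The coordinates of a Cauchy sequence converge. The tail bound for finite partial sums passes to
  the coordinatewise limit, which is therefore square-summable and also the limit in norm.
\<close>

instance ell2 :: (type) complete_space
proof
  fix X :: "nat \<Rightarrow> 'a ell2" assume X: "Cauchy X"
  have cauchy: "Cauchy (\<lambda>n. coord (X n) x)" for x
  proof (rule metric_CauchyI)
    fix e :: real assume "e > 0"
    from metric_CauchyD[OF X this] obtain M where M: "\<And>m n. m \<ge> M \<Longrightarrow> n \<ge> M \<Longrightarrow> dist (X m) (X n) < e"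
      by blast
    have "dist (coord (X m) x) (coord (X n) x) < e" if "m \<ge> M" "n \<ge> M" for m n
      using coord_le_norm[of "X m - X n" x] M[OF that] by (simp add: dist_norm)
    thus "\<exists>M. \<forall>m\<ge>M. \<forall>n\<ge>M. dist (coord (X m) x) (coord (X n) x) < e" by blast
  qed
  define g where "g x = lim (\<lambda>n. coord (X n) x)" for x
  have g: "(\<lambda>n. coord (X n) x) \<longlonglongrightarrow> g x" for x
    unfolding g_def using Cauchy_convergent[OF cauchy] by (simp add: convergent_LIMSEQ_iff)
  have tail: "coord (ell2_of (\<lambda>x. coord (X n) x - g x)) = (\<lambda>x. coord (X n) x - g x)"
      "norm (ell2_of (\<lambda>x. coord (X n) x - g x)) \<le> e"
    if e: "e > 0" and N: "\<And>m. m \<ge> N \<Longrightarrow> dist (X n) (X m) < e" for n N e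
  proof -
    have fin: "(\<Sum>x\<in>F. (coord (X n) x - g x)\<^sup>2) \<le> e\<^sup>2" if F: "finite F" for F
    proof (rule LIMSEQ_le_const2)
      show "(\<lambda>m. \<Sum>x\<in>F. (coord (X n) x - coord (X m) x)\<^sup>2) \<longlonglongrightarrow> (\<Sum>x\<in>F. (coord (X n) x - g x)\<^sup>2)"
        by (intro tendsto_intros g)
      have "(\<Sum>x\<in>F. (coord (X n) x - coord (X m) x)\<^sup>2) \<le> e\<^sup>2" if "m \<ge> N" for m
      proof -
        have "(\<Sum>x\<in>F. (coord (X n - X m) x)\<^sup>2) \<le> (norm (X n - X m))\<^sup>2"
          unfolding norm_ell2_squared by (rule finite_sum_le_infsum[OF coord_summable F]) auto
        also have "\<dots> \<le> e\<^sup>2" using N[OF that] by (intro power_mono) (auto simp: dist_norm)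
        finally show ?thesis by simp
      qed
      thus "\<exists>N. \<forall>m\<ge>N. (\<Sum>x\<in>F. (coord (X n) x - coord (X m) x)\<^sup>2) \<le> e\<^sup>2" by blast
    qed
    show "coord (ell2_of (\<lambda>x. coord (X n) x - g x)) = (\<lambda>x. coord (X n) x - g x)"
      "norm (ell2_of (\<lambda>x. coord (X n) x - g x)) \<le> e"
      using ell2_of_bound[OF fin] e by auto
  qed
  from metric_CauchyD[OF X zero_less_one] obtain N0 where "\<And>m. m \<ge> N0 \<Longrightarrow> dist (X N0) (X m) < 1" by blast
  note t0 = tail(1)[OF zero_less_one this]
  define l where "l = X N0 - ell2_of (\<lambda>x. coord (X N0) x - g x)"
  have l: "coord l x = g x" for x using t0 by (simp add: l_def)
  have "X \<longlonglongrightarrow> l"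
  proof (rule metric_LIMSEQ_I)
    fix e :: real assume e: "e > 0"
    hence "e / 2 > 0" by simp
    from metric_CauchyD[OF X this] obtain N where N: "\<And>m n. m \<ge> N \<Longrightarrow> n \<ge> N \<Longrightarrow> dist (X m) (X n) < e / 2" by blast
    have "dist (X n) l < e" if n: "n \<ge> N" for n
    proof -
      note t = tail[where N = N, OF \<open>e / 2 > 0\<close> N[OF n]]
      have "X n - l = ell2_of (\<lambda>x. coord (X n) x - g x)"
        by (intro coord_inject[THEN iffD1] ext) (simp add: t(1) l)
      thus ?thesis using t(2) e by (simp add: dist_norm)
    qed
    thus "\<exists>N. \<forall>n\<ge>N. dist (X n) l < e" by blast
  qed
  thus "convergent X" by (auto simp: convergent_def)
qed

lift_definition unit_vec :: "'v \<Rightarrow> 'v ell2" is "\<lambda>x y. if y = x then 1 else 0"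
proof -
  fix x :: 'v
  show "(\<lambda>y. (if y = x then 1 else 0 :: real)\<^sup>2) summable_on UNIV"
    by (rule finite_nonzero_values_imp_summable_on) simp
qed

lemma coord_unit_vec [simp]: "coord (unit_vec x) y = (if y = x then 1 else 0)" by transfer simp

lemma inner_unit_vec [simp]: "f \<bullet> unit_vec x = coord f x"
proof -
  have "(\<Sum>\<^sub>\<infinity>y. coord f y * coord (unit_vec x) y) = (\<Sum>\<^sub>\<infinity>y\<in>{x}. coord f y)"
    by (rule infsum_cong_neutral) auto
  thus ?thesis by (simp add: inner_ell2_eq)
qed

lemma coord_sum: "coord (\<Sum>b\<in>B. a b *\<^sub>R b) x = (\<Sum>b\<in>B. a b * coord b x)"
  by (induction B rule: infinite_finite_induct) auto

lemma orthonormal_unit_vec: "orthonormal (range unit_vec)"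
  unfolding orthonormal_def pairwise_def orthogonal_def by (auto simp: norm_eq_sqrt_inner)

lemma inj_unit_vec: "inj unit_vec"
  by (rule injI) (metis coord_unit_vec zero_neq_one)

section \<open>Compactness of the averaging operator\<close>

text \<open>
  The transition operator of the random walk on the graph; the Laplacian is the identity minus it.
\<close>

definition neighbour_average :: "('v \<Rightarrow> 'v \<Rightarrow> real) \<Rightarrow> ('v \<Rightarrow> real) \<Rightarrow> 'v \<Rightarrow> real" where
  "neighbour_average w f x = (1 / mu w x) * (\<Sum>y\<in>nbrs w x. w x y * f y)"

text \<open>
  Division by \<open>sqrt (mu w)\<close> is the unitary map from the unweighted to the weighted space.
\<close>

definition l2_of_ell2 :: "('v \<Rightarrow> 'v \<Rightarrow> real) \<Rightarrow> 'v ell2 \<Rightarrow> 'v \<Rightarrow> real" where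
  "l2_of_ell2 w g = (\<lambda>x. coord g x / sqrt (mu w x))"

text \<open>
  The transition operator transported to the unweighted space along this unitary map.
\<close>

definition average_op :: "('v \<Rightarrow> 'v \<Rightarrow> real) \<Rightarrow> 'v ell2 \<Rightarrow> 'v ell2" where
  "average_op w g = ell2_of (\<lambda>x. sqrt (mu w x) * neighbour_average w (l2_of_ell2 w g) x)"

lemma weighted_Cauchy_Schwarz:
  fixes a f :: "'b \<Rightarrow> real"
  assumes "\<And>y. y \<in> Y \<Longrightarrow> 0 \<le> a y"
  shows "(\<Sum>y\<in>Y. a y * f y)\<^sup>2 \<le> (\<Sum>y\<in>Y. a y) * (\<Sum>y\<in>Y. a y * (f y)\<^sup>2)"
proof -
  have "(\<Sum>y\<in>Y. sqrt (a y) * (sqrt (a y) * f y)) = (\<Sum>y\<in>Y. a y * f y)"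
    using assms by (intro sum.cong) (auto simp flip: mult.assoc)
  moreover have "(\<Sum>y\<in>Y. (sqrt (a y))\<^sup>2) = (\<Sum>y\<in>Y. a y)"
    using assms by (intro sum.cong) auto
  moreover have "(\<Sum>y\<in>Y. (sqrt (a y) * f y)\<^sup>2) = (\<Sum>y\<in>Y. a y * (f y)\<^sup>2)"
    using assms by (intro sum.cong) (auto simp: power_mult_distrib)
  ultimately show ?thesis
    using Cauchy_Schwarz_ineq_sum[of "\<lambda>y. sqrt (a y)" "\<lambda>y. sqrt (a y) * f y" Y] by simp
qed

lemma square_sum3_le: "(a + b + c)\<^sup>2 \<le> 3 * (a\<^sup>2 + b\<^sup>2 + c\<^sup>2)" for a b c :: real
proof -
  have "3 * (a\<^sup>2 + b\<^sup>2 + c\<^sup>2) - (a + b + c)\<^sup>2 = (a - b)\<^sup>2 + (b - c)\<^sup>2 + (a - c)\<^sup>2"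
    by (simp add: power2_eq_square algebra_simps)
  thus ?thesis by (smt (verit) zero_le_power2)
qed

locale infinite_weighted_graph = weighted_graph w for w :: "'v \<Rightarrow> 'v \<Rightarrow> real" +
  assumes infinite_vertices: "infinite (UNIV :: 'v set)"
begin

lemma nbrs_iff: "y \<in> nbrs w x \<longleftrightarrow> 0 < w x y"
  by (simp add: nbrs_def edges_def)

lemma nbrs_sym: "y \<in> nbrs w x \<longleftrightarrow> x \<in> nbrs w y"
  by (simp add: nbrs_iff weight_sym)

lemma weight_zero: "y \<notin> nbrs w x \<Longrightarrow> w x y = 0"
  using weight_nonneg[of x y] by (simp add: nbrs_iff)

lemma mu_pos: "0 < mu w x"
proof -
  obtain y where "y \<noteq> x" using infinite_vertices by (metis UNIV_I finite.simps finite_subset insertI1 subsetI)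
  with connected[of x y] obtain z where "(x, z) \<in> edges w" by (auto elim: converse_rtranclE)
  hence "z \<in> nbrs w x" by (simp add: nbrs_def)
  thus ?thesis unfolding mu_def
    by (intro sum_pos2[OF locally_finite, of z]) (auto simp: nbrs_iff weight_nonneg)
qed

lemma mu_nonneg [simp]: "0 \<le> mu w x" using mu_pos[of x] by simp
lemma mu_nonzero [simp]: "mu w x \<noteq> 0" using mu_pos[of x] by simp

lemma mu_column: "(\<Sum>x\<in>nbrs w y. w x y) = mu w y"
  unfolding mu_def by (intro sum.cong) (auto intro: weight_sym)

lemma gdist_edge: "y \<in> nbrs w x \<Longrightarrow> gdist w x0 y \<le> Suc (gdist w x0 x)"
proof -
  assume y: "y \<in> nbrs w x"
  have "\<exists>n. (x0, x) \<in> edges w ^^ n" using connected[of x0 x] by (simp add: rtrancl_power)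
  hence "(x0, x) \<in> edges w ^^ gdist w x0 x" unfolding gdist_def by (rule LeastI_ex)
  hence "(x0, y) \<in> edges w ^^ Suc (gdist w x0 x)" using y by (auto simp: nbrs_def)
  thus ?thesis unfolding gdist_def by (rule Least_le)
qed

lemma gdist_edge_cases:
  assumes "y \<in> nbrs w x"
  shows "gdist w x0 y + 1 = gdist w x0 x \<or> gdist w x0 y = gdist w x0 x \<or> gdist w x0 x + 1 = gdist w x0 y"
  using gdist_edge[OF assms, of x0] gdist_edge[of x y x0] assms nbrs_sym[of y x] by force

lemma mu_minus_bounds: "0 \<le> mu_minus w x0 x" "mu_minus w x0 x \<le> mu w x"
  unfolding mu_minus_def mu_def
  by (auto intro!: sum_nonneg sum_mono2 weight_nonneg locally_finite)

lemma mu_zero_bounds: "0 \<le> mu_zero w x0 x" "mu_zero w x0 x \<le> mu w x"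
  unfolding mu_zero_def mu_def
  by (auto intro!: sum_nonneg sum_mono2 weight_nonneg locally_finite)

text \<open>
  One half of the Schur test: if row by row \<open>q\<close> is dominated by a nonnegative kernel applied to
  \<open>f\<^sup>2\<close>, then exchanging the order of summation reduces the estimate to the column sums of the
  kernel, and only over columns in the support of \<open>f\<close>.
\<close>

lemma column_sum_bound:
  fixes c :: "'v \<Rightarrow> 'v \<Rightarrow> real"
  assumes c: "\<And>x y. 0 \<le> c x y" and C: "0 \<le> C"
    and col: "\<And>y. f y \<noteq> 0 \<Longrightarrow> (\<Sum>x\<in>nbrs w y. c x y) \<le> C * mu w y"
    and row: "\<And>x. q x \<le> (\<Sum>y\<in>nbrs w x. c x y * (f y)\<^sup>2)"
    and f: "(\<lambda>y. mu w y * (f y)\<^sup>2) summable_on UNIV" and F: "finite F"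
  shows "(\<Sum>x\<in>F. q x) \<le> C * (\<Sum>\<^sub>\<infinity>y. mu w y * (f y)\<^sup>2)"
proof -
  define Y where "Y = (\<Union>x\<in>F. nbrs w x)"
  have Y: "finite Y" using F locally_finite by (simp add: Y_def)
  have "(\<Sum>x\<in>F. q x) \<le> (\<Sum>x\<in>F. \<Sum>y\<in>nbrs w x. c x y * (f y)\<^sup>2)" by (intro sum_mono row)
  also have "\<dots> = (\<Sum>x\<in>F. \<Sum>y\<in>{y\<in>Y. y \<in> nbrs w x}. c x y * (f y)\<^sup>2)"
    by (intro sum.cong refl) (auto simp: Y_def)
  also have "\<dots> = (\<Sum>y\<in>Y. \<Sum>x\<in>{x\<in>F. y \<in> nbrs w x}. c x y * (f y)\<^sup>2)"
    by (rule sum.swap_restrict[OF F Y])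
  also have "\<dots> \<le> (\<Sum>y\<in>Y. \<Sum>x\<in>nbrs w y. c x y * (f y)\<^sup>2)"
    using nbrs_sym c by (intro sum_mono sum_mono2 locally_finite) auto
  also have "\<dots> \<le> (\<Sum>y\<in>Y. C * (mu w y * (f y)\<^sup>2))"
  proof (rule sum_mono)
    fix y
    show "(\<Sum>x\<in>nbrs w y. c x y * (f y)\<^sup>2) \<le> C * (mu w y * (f y)\<^sup>2)"
    proof (cases "f y = 0")
      case False
      from mult_right_mono[OF col[OF this], of "(f y)\<^sup>2"] show ?thesis
        by (simp add: sum_distrib_right mult.assoc)
    qed simp
  qed
  also have "\<dots> = C * (\<Sum>y\<in>Y. mu w y * (f y)\<^sup>2)" by (simp add: sum_distrib_left)
  also have "\<dots> \<le> C * (\<Sum>\<^sub>\<infinity>y. mu w y * (f y)\<^sup>2)"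
    by (intro mult_left_mono C finite_sum_le_infsum f Y) auto
  finally show ?thesis .
qed

lemma l2_of_ell2_square: "mu w x * (l2_of_ell2 w g x)\<^sup>2 = (coord g x)\<^sup>2"
  by (simp add: l2_of_ell2_def power_divide)

text \<open>
  The row hypothesis has the shape given by the weighted Cauchy-Schwarz inequality, and the choice
  of the kernel \<open>c\<close> is left open: \<open>c = w\<close> and \<open>C = 1\<close> give that the operator is a contraction, and
  a kernel adapted to the spheres around the reference vertex gives its compactness.
\<close>

lemma average_op_bound:
  fixes c :: "'v \<Rightarrow> 'v \<Rightarrow> real" and g :: "'v ell2"
  defines "f \<equiv> l2_of_ell2 w g"
  assumes c: "\<And>x y. 0 \<le> c x y" and C: "0 \<le> C"
    and col: "\<And>y. f y \<noteq> 0 \<Longrightarrow> (\<Sum>x\<in>nbrs w y. c x y) \<le> C * mu w y"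
    and row: "\<And>x. (\<Sum>y\<in>nbrs w x. w x y * f y)\<^sup>2 \<le> mu w x * (\<Sum>y\<in>nbrs w x. c x y * (f y)\<^sup>2)"
  shows "coord (average_op w g) = (\<lambda>x. sqrt (mu w x) * neighbour_average w f x)"
    "norm (average_op w g) \<le> sqrt C * norm g"
proof -
  have "(\<Sum>x\<in>F. (sqrt (mu w x) * neighbour_average w f x)\<^sup>2) \<le> (sqrt C * norm g)\<^sup>2"
    if F: "finite F" for F
  proof -
    have "(\<Sum>x\<in>F. (sqrt (mu w x) * neighbour_average w f x)\<^sup>2)
        \<le> C * (\<Sum>\<^sub>\<infinity>y. mu w y * (f y)\<^sup>2)"
    proof (rule column_sum_bound[OF c C col _ _ F])
      show "(sqrt (mu w x) * neighbour_average w f x)\<^sup>2 \<le> (\<Sum>y\<in>nbrs w x. c x y * (f y)\<^sup>2)" for x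
        using row[of x] mu_pos[of x]
        by (simp add: neighbour_average_def power_mult_distrib power_divide power2_eq_square[of "mu w x"] field_simps)
      show "(\<lambda>y. mu w y * (f y)\<^sup>2) summable_on UNIV"
        unfolding f_def l2_of_ell2_square by (rule coord_summable)
    qed
    also have "\<dots> = (sqrt C * norm g)\<^sup>2"
      unfolding f_def l2_of_ell2_square using C by (simp add: power_mult_distrib norm_ell2_squared)
    finally show ?thesis .
  qed
  from ell2_of_bound[OF this] C
  show "coord (average_op w g) = (\<lambda>x. sqrt (mu w x) * neighbour_average w f x)"
    "norm (average_op w g) \<le> sqrt C * norm g"
    unfolding average_op_def f_def by auto
qed

lemma coord_average_op: "coord (average_op w g) x = sqrt (mu w x) * neighbour_average w (l2_of_ell2 w g) x"
  and norm_average_op: "norm (average_op w g) \<le> norm g"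
proof -
  have col: "(\<Sum>x\<in>nbrs w y. w x y) \<le> 1 * mu w y" for y by (simp add: mu_column)
  have row: "(\<Sum>y\<in>nbrs w x. w x y * f y)\<^sup>2 \<le> mu w x * (\<Sum>y\<in>nbrs w x. w x y * (f y)\<^sup>2)" for x f
    unfolding mu_def by (rule weighted_Cauchy_Schwarz) (rule weight_nonneg)
  note * = average_op_bound[of w 1 g, OF weight_nonneg _ col row]
  show "coord (average_op w g) x = sqrt (mu w x) * neighbour_average w (l2_of_ell2 w g) x"
    using *(1) by simp
  show "norm (average_op w g) \<le> norm g" using *(2) by simp
qed

lemma coord_average_op': "coord (average_op w g) x = (\<Sum>y\<in>nbrs w x. w x y / (sqrt (mu w x) * sqrt (mu w y)) * coord g y)"
proof -
  have "sqrt (mu w x) / mu w x = 1 / sqrt (mu w x)"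
    using mu_pos[of x] by (simp add: divide_simps)
  moreover have "coord (average_op w g) x
      = (sqrt (mu w x) / mu w x) * (\<Sum>y\<in>nbrs w x. w x y * (coord g y / sqrt (mu w y)))"
    by (simp add: coord_average_op neighbour_average_def l2_of_ell2_def)
  ultimately have "coord (average_op w g) x
      = (1 / sqrt (mu w x)) * (\<Sum>y\<in>nbrs w x. w x y * (coord g y / sqrt (mu w y)))"
    by (simp only:)
  also have "\<dots> = (\<Sum>y\<in>nbrs w x. w x y / (sqrt (mu w x) * sqrt (mu w y)) * coord g y)"
    unfolding sum_distrib_left by (intro sum.cong) (auto simp: field_simps)
  finally show ?thesis .
qed

lemma bounded_linear_average_op: "bounded_linear (average_op w)"
proof (rule bounded_linear_intro[where K = 1])
  show "average_op w (f + g) = average_op w f + average_op w g" for f g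
    by (intro coord_inject[THEN iffD1] ext) (simp add: coord_average_op' distrib_left sum.distrib)
  show "average_op w (r *\<^sub>R f) = r *\<^sub>R average_op w f" for r f
    by (intro coord_inject[THEN iffD1] ext) (simp add: coord_average_op' sum_distrib_left mult_ac)
  show "norm (average_op w f) \<le> norm f * 1" for f using norm_average_op[of f] by simp
qed

text \<open>
  The dominating family for the exchange of summation in the proof of self-adjointness.
\<close>

lemma weighted_square_summable:
  "(\<lambda>(x, y). w x y * (l2_of_ell2 w h x)\<^sup>2) summable_on UNIV \<times> UNIV"
proof (rule nonneg_bdd_above_summable_on)
  show "0 \<le> (case z of (x, y) \<Rightarrow> w x y * (l2_of_ell2 w h x)\<^sup>2)" for z
    by (auto intro: mult_nonneg_nonneg weight_nonneg split: prod.split)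
  show "bdd_above (sum (\<lambda>(x, y). w x y * (l2_of_ell2 w h x)\<^sup>2) ` {F. F \<subseteq> UNIV \<times> UNIV \<and> finite F})"
  proof (rule bdd_aboveI2[where M = "(norm h)\<^sup>2"])
    fix Z :: "('v \<times> 'v) set" assume "Z \<in> {F. F \<subseteq> UNIV \<times> UNIV \<and> finite F}"
    hence Z: "finite Z" by simp
    have "(\<Sum>(x, y)\<in>Z. w x y * (l2_of_ell2 w h x)\<^sup>2)
        \<le> (\<Sum>(x, y)\<in>fst ` Z \<times> snd ` Z. w x y * (l2_of_ell2 w h x)\<^sup>2)"
      using Z by (intro sum_mono2) (auto intro: rev_image_eqI mult_nonneg_nonneg weight_nonneg)
    also have "\<dots> = (\<Sum>x\<in>fst ` Z. (\<Sum>y\<in>snd ` Z. w x y) * (l2_of_ell2 w h x)\<^sup>2)"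
      by (simp add: sum.cartesian_product[symmetric] sum_distrib_right)
    also have "\<dots> \<le> (\<Sum>x\<in>fst ` Z. mu w x * (l2_of_ell2 w h x)\<^sup>2)"
    proof (intro sum_mono mult_right_mono)
      fix x
      have "(\<Sum>y\<in>snd ` Z. w x y) = (\<Sum>y\<in>snd ` Z \<inter> nbrs w x. w x y)"
        using Z by (intro sum.mono_neutral_right) (auto simp: weight_zero)
      also have "\<dots> \<le> mu w x" unfolding mu_def
        by (intro sum_mono2 locally_finite) (auto simp: weight_nonneg)
      finally show "(\<Sum>y\<in>snd ` Z. w x y) \<le> mu w x" .
    qed auto
    also have "\<dots> \<le> (norm h)\<^sup>2"
      unfolding l2_of_ell2_square norm_ell2_squared using Z
      by (intro finite_sum_le_infsum coord_summable) auto
    finally show "(\<Sum>(x, y)\<in>Z. w x y * (l2_of_ell2 w h x)\<^sup>2) \<le> (norm h)\<^sup>2" .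
  qed
qed

lemma average_op_inner:
  "average_op w g \<bullet> h = (\<Sum>\<^sub>\<infinity>x. \<Sum>\<^sub>\<infinity>y. w x y * l2_of_ell2 w g y * l2_of_ell2 w h x)"
proof -
  have "coord (average_op w g) x * coord h x = (\<Sum>\<^sub>\<infinity>y. w x y * l2_of_ell2 w g y * l2_of_ell2 w h x)" for x
  proof -
    have "(\<Sum>\<^sub>\<infinity>y. w x y * l2_of_ell2 w g y * l2_of_ell2 w h x)
        = (\<Sum>\<^sub>\<infinity>y\<in>nbrs w x. w x y * l2_of_ell2 w g y * l2_of_ell2 w h x)"
      by (rule infsum_cong_neutral) (auto simp: weight_zero)
    also have "\<dots> = (\<Sum>y\<in>nbrs w x. w x y * l2_of_ell2 w g y * l2_of_ell2 w h x)"
      by (simp add: locally_finite)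
    also have "\<dots> = coord (average_op w g) x * coord h x"
      unfolding coord_average_op' sum_distrib_right l2_of_ell2_def
      by (intro sum.cong) (auto simp: field_simps)
    finally show ?thesis by simp
  qed
  thus ?thesis by (simp add: inner_ell2_eq)
qed

lemma selfadjoint_average_op: "selfadjoint (average_op w)"
  unfolding selfadjoint_def
proof (intro allI)
  fix g h :: "'v ell2"
  let ?f = "l2_of_ell2 w g" and ?k = "l2_of_ell2 w h"
  let ?q = "\<lambda>(x, y). w x y * ?f y * ?k x"
  have sk: "(\<lambda>(x, y). w x y * (?k x)\<^sup>2) summable_on UNIV \<times> UNIV" by (rule weighted_square_summable)
  have "(\<lambda>(x, y). w y x * (?f y)\<^sup>2) summable_on UNIV \<times> UNIV"
    using weighted_square_summable[of g] by (subst (asm) summable_on_swap) (simp add: case_prod_unfold o_def prod.swap_def)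
  hence sf: "(\<lambda>(x, y). w x y * (?f y)\<^sup>2) summable_on UNIV \<times> UNIV"
    by (simp add: weight_sym)
  have sum: "(\<lambda>z. (case z of (x, y) \<Rightarrow> w x y * (?f y)\<^sup>2) + (case z of (x, y) \<Rightarrow> w x y * (?k x)\<^sup>2)) summable_on UNIV \<times> UNIV"
    by (rule summable_on_add[OF sf sk])
  have "(\<lambda>z. norm (?q z)) summable_on UNIV \<times> UNIV"
  proof (rule summable_on_comparison_test[OF sum])
    fix z :: "'v \<times> 'v"
    obtain x y where z: "z = (x, y)" by (cases z)
    have "2 * \<bar>?f y\<bar> * \<bar>?k x\<bar> \<le> (?f y)\<^sup>2 + (?k x)\<^sup>2"
      using sum_squares_bound[of "\<bar>?f y\<bar>" "\<bar>?k x\<bar>"] by simp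
    moreover have "0 \<le> \<bar>?f y\<bar> * \<bar>?k x\<bar>" by simp
    ultimately have "\<bar>?f y\<bar> * \<bar>?k x\<bar> \<le> (?f y)\<^sup>2 + (?k x)\<^sup>2" by linarith
    from mult_left_mono[OF this weight_nonneg[of x y]]
    show "norm (?q z) \<le> (case z of (x, y) \<Rightarrow> w x y * (?f y)\<^sup>2) + (case z of (x, y) \<Rightarrow> w x y * (?k x)\<^sup>2)"
      using weight_nonneg[of x y] by (simp add: z abs_mult distrib_left mult.assoc)
  qed auto
  hence "?q summable_on UNIV \<times> UNIV" by (rule abs_summable_summable)
  hence "average_op w g \<bullet> h = (\<Sum>\<^sub>\<infinity>y. \<Sum>\<^sub>\<infinity>x. w x y * ?f y * ?k x)"
    unfolding average_op_inner by (rule infsum_swap_banach)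
  also have "\<dots> = (\<Sum>\<^sub>\<infinity>y. \<Sum>\<^sub>\<infinity>x. w y x * ?k x * ?f y)"
    by (intro infsum_cong) (simp add: weight_sym mult_ac)
  also have "\<dots> = average_op w h \<bullet> g" by (simp add: average_op_inner)
  finally show "average_op w g \<bullet> h = g \<bullet> average_op w h" by (simp add: inner_commute)
qed

text \<open>
  The neighbours of \<open>x\<close> are split into those closer to \<open>x0\<close>, those at the same distance and those
  farther away, and the weighted Cauchy-Schwarz inequality is applied to each part. The total
  weights of the first two parts are \<open>mu_minus\<close> and \<open>mu_zero\<close> at \<open>x\<close>, hence small.
\<close>

lemma average_row_bound:
  assumes e: "mu_minus w x0 x \<le> e * mu w x" "mu_zero w x0 x \<le> e * mu w x"
  shows "(\<Sum>y\<in>nbrs w x. w x y * f y)\<^sup>2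
    \<le> mu w x * (\<Sum>y\<in>nbrs w x. 3 * (w x y * (if gdist w x0 x + 1 = gdist w x0 y then 1 else e)) * (f y)\<^sup>2)"
proof -
  define N where "N = nbrs w x"
  define Nm where "Nm = {y \<in> N. gdist w x0 y + 1 = gdist w x0 x}"
  define Nz where "Nz = {y \<in> N. gdist w x0 y = gdist w x0 x}"
  define Np where "Np = {y \<in> N. gdist w x0 x + 1 = gdist w x0 y}"
  have fin: "finite Nm" "finite Nz" "finite Np" using locally_finite by (auto simp: N_def Nm_def Nz_def Np_def)
  have split: "sum h N = sum h Nm + sum h Nz + sum h Np" for h :: "'v \<Rightarrow> real"
  proof -
    have "y \<in> Nm \<union> Nz \<union> Np" if "y \<in> N" for y
      using gdist_edge_cases[of y x x0] that by (simp add: N_def Nm_def Nz_def Np_def)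
    hence "N = Nm \<union> Nz \<union> Np" by (auto simp: Nm_def Nz_def Np_def)
    moreover have "Nm \<inter> Nz = {}" "(Nm \<union> Nz) \<inter> Np = {}" by (auto simp: Nm_def Nz_def Np_def)
    ultimately show ?thesis using fin by (simp add: sum.union_disjoint)
  qed
  define S where "S A = (\<Sum>y\<in>A. w x y * (f y)\<^sup>2)" for A
  have S0: "0 \<le> S A" for A unfolding S_def by (intro sum_nonneg mult_nonneg_nonneg weight_nonneg) auto
  have CS: "(\<Sum>y\<in>A. w x y * f y)\<^sup>2 \<le> (\<Sum>y\<in>A. w x y) * S A" for A
    unfolding S_def by (rule weighted_Cauchy_Schwarz) (rule weight_nonneg)
  have m: "(\<Sum>y\<in>Nm. w x y) \<le> e * mu w x" using e(1) by (simp add: mu_minus_def Nm_def N_def)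
  have z: "(\<Sum>y\<in>Nz. w x y) \<le> e * mu w x" using e(2) by (simp add: mu_zero_def Nz_def N_def)
  have p: "(\<Sum>y\<in>Np. w x y) \<le> mu w x"
    unfolding mu_def Np_def N_def by (intro sum_mono2 locally_finite) (auto simp: weight_nonneg)
  have "(\<Sum>y\<in>N. w x y * f y)\<^sup>2
      \<le> 3 * ((\<Sum>y\<in>Nm. w x y * f y)\<^sup>2 + (\<Sum>y\<in>Nz. w x y * f y)\<^sup>2 + (\<Sum>y\<in>Np. w x y * f y)\<^sup>2)"
    unfolding split by (rule square_sum3_le)
  also have "\<dots> \<le> 3 * (e * mu w x * S Nm + e * mu w x * S Nz + mu w x * S Np)"
    by (intro mult_left_mono add_mono order_trans[OF CS] mult_right_mono m z p S0) simp
  also have "\<dots> = mu w x * (3 * (e * S Nm + e * S Nz + S Np))" by (simp add: algebra_simps)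
  also have "3 * (e * S Nm + e * S Nz + S Np) =
      (\<Sum>y\<in>N. 3 * (w x y * (if gdist w x0 x + 1 = gdist w x0 y then 1 else e)) * (f y)\<^sup>2)"
  proof -
    have "(\<Sum>y\<in>Nm. 3 * (w x y * (if gdist w x0 x + 1 = gdist w x0 y then 1 else e)) * (f y)\<^sup>2) = 3 * (e * S Nm)"
      "(\<Sum>y\<in>Nz. 3 * (w x y * (if gdist w x0 x + 1 = gdist w x0 y then 1 else e)) * (f y)\<^sup>2) = 3 * (e * S Nz)"
      "(\<Sum>y\<in>Np. 3 * (w x y * (if gdist w x0 x + 1 = gdist w x0 y then 1 else e)) * (f y)\<^sup>2) = 3 * S Np"
      unfolding S_def sum_distrib_left by (auto simp: Nm_def Nz_def Np_def intro!: sum.cong)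
    thus ?thesis unfolding split by simp
  qed
  finally show ?thesis by (simp add: N_def)
qed

text \<open>
  The part without the factor \<open>e\<close> is small after summation over the other index: the vertices \<open>x\<close>
  for which \<open>y\<close> is a farther neighbour are the neighbours of \<open>y\<close> closer to \<open>x0\<close>, and their weights
  add up to \<open>mu_minus\<close> at \<open>y\<close>.
\<close>

lemma average_column_bound:
  assumes e: "mu_minus w x0 y \<le> e * mu w y" and e0: "0 \<le> e"
  shows "(\<Sum>x\<in>nbrs w y. 3 * (w x y * (if gdist w x0 x + 1 = gdist w x0 y then 1 else e))) \<le> 6 * e * mu w y"
proof -
  have "(\<Sum>x\<in>nbrs w y. w x y * (if gdist w x0 x + 1 = gdist w x0 y then 1 else e))
      \<le> (\<Sum>x\<in>nbrs w y. (if gdist w x0 x + 1 = gdist w x0 y then w y x else 0) + e * w x y)"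
    by (intro sum_mono) (auto simp: e0 weight_nonneg weight_sym)
  also have "\<dots> = mu_minus w x0 y + e * mu w y"
    by (simp add: sum.distrib mu_minus_def mu_column sum.If_cases locally_finite Int_def flip: sum_distrib_left)
  also have "\<dots> \<le> 2 * e * mu w y" using e by simp
  finally show ?thesis by (simp flip: sum_distrib_left)
qed

text \<open>
  For functions vanishing on a finite set \<open>K\<close> outside of which the two ratios are at most \<open>e\<close>, and
  on all neighbours of \<open>K\<close>, the row and column bounds show that the operator has norm at most
  \<open>sqrt (6 * e)\<close>.
\<close>

lemma compact_average_op:
  assumes small: "\<And>e. e > 0 \<Longrightarrow> \<exists>K. finite K \<and>
    (\<forall>x. x \<notin> K \<longrightarrow> mu_minus w x0 x \<le> e * mu w x \<and> mu_zero w x0 x \<le> e * mu w x)"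
  shows "compact_op (average_op w)"
  unfolding compact_op_def
proof (intro allI impI)
  fix \<epsilon> :: real assume \<epsilon>: "\<epsilon> > 0"
  define e where "e = \<epsilon>\<^sup>2 / 6"
  have e: "e > 0" using \<epsilon> by (simp add: e_def)
  from small[OF this] obtain K where K: "finite K"
    "\<And>x. x \<notin> K \<Longrightarrow> mu_minus w x0 x \<le> e * mu w x" "\<And>x. x \<notin> K \<Longrightarrow> mu_zero w x0 x \<le> e * mu w x" by blast
  \<comment> \<open>with the neighbours of \<open>K\<close> included, the average vanishes on \<open>K\<close>, where the row bound is not available\<close>
  define K' where "K' = K \<union> (\<Union>x\<in>K. nbrs w x)"
  have "finite (unit_vec ` K')" using K(1) locally_finite by (simp add: K'_def)
  moreover have "orthonormal (unit_vec ` K')" by (rule orthonormal_mono[OF orthonormal_unit_vec]) auto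
  moreover have "norm (average_op w g) \<le> \<epsilon> * norm g" if g: "\<forall>b\<in>unit_vec ` K'. g \<bullet> b = 0" for g
  proof -
    have z: "l2_of_ell2 w g y = 0" if "y \<in> K'" for y
      using g that by (simp add: l2_of_ell2_def)
    have "norm (average_op w g) \<le> sqrt (6 * e) * norm g"
    proof (rule average_op_bound(2))
      let ?c = "\<lambda>x y. 3 * (w x y * (if gdist w x0 x + 1 = gdist w x0 y then 1 else e))"
      show "0 \<le> ?c x y" for x y using e weight_nonneg[of x y] by simp
      show "0 \<le> 6 * e" using e by simp
      show "(\<Sum>x\<in>nbrs w y. ?c x y) \<le> 6 * e * mu w y" if "l2_of_ell2 w g y \<noteq> 0" for y
        using z[of y] that K(2)[of y] e by (intro average_column_bound) (auto simp: K'_def)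
      show "(\<Sum>y\<in>nbrs w x. w x y * l2_of_ell2 w g y)\<^sup>2
          \<le> mu w x * (\<Sum>y\<in>nbrs w x. ?c x y * (l2_of_ell2 w g y)\<^sup>2)" for x
      proof (cases "x \<in> K")
        case True
        hence "l2_of_ell2 w g y = 0" if "y \<in> nbrs w x" for y using that by (intro z) (auto simp: K'_def)
        thus ?thesis by simp
      next
        case False
        thus ?thesis using K by (intro average_row_bound) auto
      qed
    qed
    moreover have "sqrt (6 * e) = \<epsilon>" using \<epsilon> by (simp add: e_def)
    ultimately show ?thesis by simp
  qed
  ultimately show "\<exists>B. finite B \<and> orthonormal B \<and>
      (\<forall>g. (\<forall>b\<in>B. g \<bullet> b = 0) \<longrightarrow> norm (average_op w g) \<le> \<epsilon> * norm g)" by blast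
qed

end

section \<open>The spectrum of the Laplacian\<close>

context infinite_weighted_graph
begin

lemma bij_betw_l2_of_ell2: "bij_betw (l2_of_ell2 w) UNIV (l2 w)"
proof (rule bij_betwI')
  show "l2_of_ell2 w f = l2_of_ell2 w g \<longleftrightarrow> f = g" for f g
  proof
    assume eq: "l2_of_ell2 w f = l2_of_ell2 w g"
    have "coord f x = coord g x" for x using fun_cong[OF eq, of x] by (simp add: l2_of_ell2_def)
    thus "f = g" by (intro coord_inject[THEN iffD1] ext)
  qed simp
  have sq: "mu w x * f x * f x = mu w x * (f x)\<^sup>2" for f and x by (simp add: power2_eq_square)
  show "l2_of_ell2 w g \<in> l2 w" for g
    unfolding l2_def mem_Collect_eq sq l2_of_ell2_square by (rule coord_summable)
  show "\<exists>g\<in>UNIV. f = l2_of_ell2 w g" if "f \<in> l2 w" for f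
  proof (intro bexI ext)
    have "(\<lambda>x. (sqrt (mu w x) * f x)\<^sup>2) summable_on UNIV"
      using that by (simp add: l2_def sq power_mult_distrib)
    thus "f x = l2_of_ell2 w (ell2_of (\<lambda>x. sqrt (mu w x) * f x)) x" for x
      by (simp add: l2_of_ell2_def ell2_of_inverse)
  qed simp
qed

lemma l2_of_ell2_sum:
  "l2_of_ell2 w (\<Sum>b\<in>B. a b *\<^sub>R b) x = (\<Sum>b\<in>B. a b * l2_of_ell2 w b x)"
  by (simp add: l2_of_ell2_def coord_sum sum_divide_distrib)

lemma l2_norm_l2_of_ell2: "l2_norm w (l2_of_ell2 w g) = norm g"
proof -
  have "mu w x * l2_of_ell2 w g x * l2_of_ell2 w g x = (coord g x)\<^sup>2" for x
    using l2_of_ell2_square[of x g] by (simp add: power2_eq_square mult.assoc)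
  hence "l2_inner w (l2_of_ell2 w g) (l2_of_ell2 w g) = (norm g)\<^sup>2"
    by (simp add: l2_inner_def norm_ell2_squared)
  thus ?thesis by (simp add: l2_norm_def)
qed

lemma laplacian_l2_of_ell2:
  "laplacian w (l2_of_ell2 w g) x - c * l2_of_ell2 w g x
    = l2_of_ell2 w ((1 - c) *\<^sub>R g - average_op w g) x"
proof -
  have "l2_of_ell2 w (average_op w g) x = neighbour_average w (l2_of_ell2 w g) x"
    by (simp add: l2_of_ell2_def[of w "average_op w g"] coord_average_op)
  moreover have "l2_of_ell2 w ((1 - c) *\<^sub>R g - average_op w g) x
      = (1 - c) * l2_of_ell2 w g x - l2_of_ell2 w (average_op w g) x"
    by (simp add: l2_of_ell2_def diff_divide_distrib)
  ultimately show ?thesis by (simp add: laplacian_def neighbour_average_def algebra_simps)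
qed

text \<open>
  The unitary map intertwines \<open>laplacian w - c\<close> with \<open>(1 - c) - average_op w\<close>, so invertibility
  and the bound for the inverse carry over.
\<close>

lemma spectrum_laplacian_iff:
  "c \<in> spectrum w (laplacian w) \<longleftrightarrow>
    \<not> (bij (\<lambda>g. (1 - c) *\<^sub>R g - average_op w g) \<and>
       (\<exists>C. \<forall>g. norm g \<le> C * norm ((1 - c) *\<^sub>R g - average_op w g)))"
proof -
  let ?V = "l2_of_ell2 w" and ?D = "\<lambda>f x. laplacian w f x - c * f x"
  let ?T = "\<lambda>g. (1 - c) *\<^sub>R g - average_op w g"
  have DV: "?D (?V g) = ?V (?T g)" for g by (rule ext) (rule laplacian_l2_of_ell2)
  have "bij_betw ?D (l2 w) (l2 w) \<longleftrightarrow> bij_betw (?D \<circ> ?V) UNIV (l2 w)"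
    by (rule bij_betw_comp_iff[OF bij_betw_l2_of_ell2])
  also have "?D \<circ> ?V = ?V \<circ> ?T" by (rule ext) (simp only: o_apply DV)
  also have "bij_betw (?V \<circ> ?T) UNIV (l2 w) \<longleftrightarrow> bij ?T"
    by (rule bij_betw_comp_iff2[OF bij_betw_l2_of_ell2, symmetric]) simp
  finally have 1: "bij_betw ?D (l2 w) (l2 w) \<longleftrightarrow> bij ?T" .
  have im: "l2 w = range ?V" using bij_betw_l2_of_ell2 by (simp add: bij_betw_def)
  have 2: "(\<forall>f\<in>l2 w. l2_norm w f \<le> C * l2_norm w (?D f)) \<longleftrightarrow> (\<forall>g. norm g \<le> C * norm (?T g))" for C
    by (simp only: im ball_simps DV l2_norm_l2_of_ell2 UNIV_I simp_thms)
  show ?thesis unfolding spectrum_def mem_Collect_eq 1 2 ..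
qed

lemma eigenspace_laplacian:
  "eigenspace w (laplacian w) c = l2_of_ell2 w ` {g. average_op w g = (1 - c) *\<^sub>R g}"
proof -
  have inj: "inj (l2_of_ell2 w)" and im: "l2 w = range (l2_of_ell2 w)"
    using bij_betw_l2_of_ell2 by (auto simp: bij_betw_def)
  have "(\<forall>x. laplacian w (l2_of_ell2 w g) x = c * l2_of_ell2 w g x) \<longleftrightarrow> average_op w g = (1 - c) *\<^sub>R g" for g
  proof -
    have "(\<forall>x. laplacian w (l2_of_ell2 w g) x = c * l2_of_ell2 w g x)
        \<longleftrightarrow> l2_of_ell2 w ((1 - c) *\<^sub>R g - average_op w g) = l2_of_ell2 w 0"
      by (auto simp: fun_eq_iff l2_of_ell2_def[of w 0] simp flip: laplacian_l2_of_ell2)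
    also have "\<dots> \<longleftrightarrow> average_op w g = (1 - c) *\<^sub>R g" using inj by (auto simp: inj_eq)
    finally show ?thesis .
  qed
  thus ?thesis unfolding eigenspace_def im by auto
qed

lemma eigenvalue_laplacian_iff:
  "eigenvalue w (laplacian w) c \<longleftrightarrow> (\<exists>g. g \<noteq> 0 \<and> average_op w g = (1 - c) *\<^sub>R g)"
proof -
  have "(\<exists>x. l2_of_ell2 w g x \<noteq> 0) \<longleftrightarrow> g \<noteq> 0" for g
  proof -
    have "(\<forall>x. l2_of_ell2 w g x = 0) \<longleftrightarrow> coord g = coord 0" by (auto simp: l2_of_ell2_def fun_eq_iff)
    thus ?thesis by (metis coord_inject)
  qed
  thus ?thesis unfolding eigenvalue_def eigenspace_laplacian by auto
qed

lemma eigenvalue_in_spectrum: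
  assumes "eigenvalue w (laplacian w) c" shows "c \<in> spectrum w (laplacian w)"
proof -
  obtain g where g: "g \<noteq> 0" "average_op w g = (1 - c) *\<^sub>R g" using assms by (auto simp: eigenvalue_laplacian_iff)
  moreover have "average_op w 0 = 0" using bounded_linear_average_op by (rule linear_simps(3))
  ultimately have "\<not> inj (\<lambda>g. (1 - c) *\<^sub>R g - average_op w g)" by (auto dest: injD[of _ g 0])
  thus ?thesis by (auto simp: spectrum_laplacian_iff bij_def)
qed

lemma spectrum_imp_eigenvalue:
  assumes comp: "compact_op (average_op w)" and c: "c \<in> spectrum w (laplacian w)" "c \<noteq> 1"
  shows "eigenvalue w (laplacian w) c"
proof (rule ccontr)
  assume "\<not> ?thesis"
  hence inj: "g = 0" if "average_op w g = (1 - c) *\<^sub>R g" for g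
    using that by (auto simp: eigenvalue_laplacian_iff)
  interpret A: bounded_linear "average_op w" by (rule bounded_linear_average_op)
  have "1 - c \<noteq> 0" using c by simp
  note F = compact_selfadjoint_fredholm[OF bounded_linear_average_op comp selfadjoint_average_op this inj]
  have "inj (\<lambda>g. (1 - c) *\<^sub>R g - average_op w g)"
  proof (rule injI)
    fix g h assume "(1 - c) *\<^sub>R g - average_op w g = (1 - c) *\<^sub>R h - average_op w h"
    hence "average_op w (g - h) = (1 - c) *\<^sub>R (g - h)" by (simp add: A.diff algebra_simps)
    from inj[OF this] show "g = h" by simp
  qed
  with F c(1) show False by (auto simp: spectrum_laplacian_iff bij_def)
qed

text \<open>
  Near \<open>c \<noteq> 1\<close> all points \<open>y\<close> of the spectrum satisfy \<open>\<bar>1 - y\<bar> \<ge> \<bar>1 - c\<bar> / 2\<close>, so that \<open>1 - y\<close> is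
  one of finitely many eigenvalues of the averaging operator.
\<close>

lemma spectrum_isolated:
  assumes comp: "compact_op (average_op w)" and c: "c \<in> spectrum w (laplacian w)" "c \<noteq> 1"
  shows "c isolated_in spectrum w (laplacian w)"
proof -
  define r where "r = \<bar>1 - c\<bar> / 2"
  have r: "r > 0" using c by (simp add: r_def)
  define E where "E = {l. \<bar>l\<bar> \<ge> r \<and> (\<exists>g. g \<noteq> 0 \<and> average_op w g = l *\<^sub>R g)}"
  have "finite E" unfolding E_def
    by (rule compact_selfadjoint_eigenvalues_discrete[OF bounded_linear_average_op comp selfadjoint_average_op r])
  hence "finite ((\<lambda>l. 1 - l) ` E)" by simp
  from finite_set_avoid[OF this, of c] obtain d where d: "d > 0"
    "\<And>x. x \<in> (\<lambda>l. 1 - l) ` E \<Longrightarrow> x \<noteq> c \<Longrightarrow> d \<le> dist c x" by auto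
  have "y = c" if y: "y \<in> spectrum w (laplacian w)" "dist c y < min d r" for y
  proof (rule ccontr)
    assume ne: "y \<noteq> c"
    have "\<bar>1 - y\<bar> \<ge> r" using y(2) by (simp add: dist_real_def r_def abs_if split: if_splits)
    moreover have "y \<noteq> 1" using calculation r by auto
    ultimately have "1 - y \<in> E" using spectrum_imp_eigenvalue[OF comp y(1)]
      by (auto simp: E_def eigenvalue_laplacian_iff)
    hence "y \<in> (\<lambda>l. 1 - l) ` E" by (rule rev_image_eqI) simp
    from d(2)[OF this ne] y(2) show False by simp
  qed
  moreover have "min d r > 0" using d(1) r by simp
  ultimately show ?thesis unfolding isolated_in_dist_Ex_iff using c(1) by blast
qed

lemma eigenspace_finite_multiplicity:
  assumes comp: "compact_op (average_op w)" and c: "c \<noteq> 1"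
  shows "finite_multiplicity w (laplacian w) c"
proof -
  have "1 - c \<noteq> 0" using c by simp
  from compact_op_eigenspace_finite_dim[OF bounded_linear_average_op comp this]
  obtain B where B: "finite B" "B \<subseteq> {g. average_op w g = (1 - c) *\<^sub>R g}"
    "\<And>g. average_op w g = (1 - c) *\<^sub>R g \<Longrightarrow> g = (\<Sum>b\<in>B. (g \<bullet> b) *\<^sub>R b)" by blast
  have inj: "inj (l2_of_ell2 w)" using bij_betw_l2_of_ell2 by (simp add: bij_betw_def)
  have "\<exists>a. \<forall>x. f x = (\<Sum>b\<in>l2_of_ell2 w ` B. a b * b x)" if "f \<in> eigenspace w (laplacian w) c" for f
  proof -
    obtain g where g: "f = l2_of_ell2 w g" "average_op w g = (1 - c) *\<^sub>R g"
      using \<open>f \<in> _\<close> by (auto simp: eigenspace_laplacian)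
    have "f x = (\<Sum>b\<in>l2_of_ell2 w ` B. (g \<bullet> inv (l2_of_ell2 w) b) * b x)" for x
    proof -
      have "f x = l2_of_ell2 w (\<Sum>b\<in>B. (g \<bullet> b) *\<^sub>R b) x"
        using B(3)[OF g(2)] by (simp add: g(1))
      also have "\<dots> = (\<Sum>b\<in>B. (g \<bullet> b) * l2_of_ell2 w b x)"
        by (rule l2_of_ell2_sum)
      also have "\<dots> = (\<Sum>b\<in>l2_of_ell2 w ` B. (g \<bullet> inv (l2_of_ell2 w) b) * b x)"
        using inj by (subst sum.reindex) (auto intro: inj_on_subset)
      finally show ?thesis .
    qed
    thus ?thesis by (intro exI allI)
  qed
  thus ?thesis unfolding finite_multiplicity_def
    by (intro exI[of _ "l2_of_ell2 w ` B"]) (use B in \<open>auto simp: eigenspace_laplacian\<close>)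
qed

text \<open>
  Both ways for \<open>1\<close> to escape the essential spectrum contradict the existence of infinitely many
  orthonormal eigenvectors of the averaging operator with arbitrarily small eigenvalues. An inverse
  bounded by \<open>C\<close> excludes eigenvalues of modulus below \<open>1 / C\<close>. If \<open>1\<close> is isolated, then all of
  these eigenvectors belong to the eigenvalue \<open>0\<close>, which then has infinite multiplicity.
\<close>

lemma one_in_ess_spectrum:
  assumes comp: "compact_op (average_op w)"
  shows "1 \<in> ess_spectrum w (laplacian w)"
proof -
  let ?A = "average_op w"
  have small: "\<exists>S. infinite S \<and> orthonormal S \<and> (\<forall>s\<in>S. \<exists>l. \<bar>l\<bar> < d \<and> ?A s = l *\<^sub>R s)" if "d > 0" for d
  proof -
    have "infinite (range (unit_vec :: 'v \<Rightarrow> _))"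
      using infinite_vertices finite_imageD[OF _ inj_unit_vec] by blast
    from compact_selfadjoint_small_eigenvectors[OF bounded_linear_average_op comp selfadjoint_average_op that this
        orthonormal_unit_vec] show ?thesis by metis
  qed
  have spec: "1 \<in> spectrum w (laplacian w)"
  proof (rule ccontr)
    assume "\<not> ?thesis"
    then obtain C where C: "\<And>g. norm g \<le> C * norm (?A g)" by (auto simp: spectrum_laplacian_iff)
    \<comment> \<open>a positive bound, as \<open>C\<close> itself may be any real number\<close>
    define D where "D = \<bar>C\<bar> + 1"
    have "1 / D > 0" by (simp add: D_def)
    from small[OF this] obtain S where S: "infinite S" "orthonormal S" "\<forall>s\<in>S. \<exists>l. \<bar>l\<bar> < 1 / D \<and> ?A s = l *\<^sub>R s" by blast
    then obtain s l where s: "s \<in> S" "\<bar>l\<bar> < 1 / D" "?A s = l *\<^sub>R s"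
      by (metis infinite_imp_nonempty ex_in_conv)
    have "norm s = 1" using S s by (simp add: orthonormal_def)
    hence "1 \<le> C * \<bar>l\<bar>" using C[of s] s(3) by simp
    also have "\<dots> \<le> D * \<bar>l\<bar>" by (rule mult_right_mono) (auto simp: D_def)
    also have "\<dots> < 1" using s(2) by (simp add: D_def field_simps)
    finally show False by simp
  qed
  have "\<not> finite_multiplicity w (laplacian w) 1" if iso: "1 isolated_in spectrum w (laplacian w)"
  proof
    assume "finite_multiplicity w (laplacian w) 1"
    then obtain B where B: "finite B" "B \<subseteq> eigenspace w (laplacian w) 1"
      "\<And>f. f \<in> eigenspace w (laplacian w) 1 \<Longrightarrow> \<exists>a. \<forall>x. f x = (\<Sum>b\<in>B. a b * b x)"
      unfolding finite_multiplicity_def by blast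
    obtain d where d: "d > 0" "\<And>y. y \<in> spectrum w (laplacian w) \<Longrightarrow> dist 1 y < d \<Longrightarrow> y = 1"
      using iso unfolding isolated_in_dist_Ex_iff by blast
    obtain S where S: "infinite S" "orthonormal S" "\<And>s. s \<in> S \<Longrightarrow> \<exists>l. \<bar>l\<bar> < d \<and> ?A s = l *\<^sub>R s"
      using small[OF d(1)] by blast
    obtain B' where B': "finite B'" "B = l2_of_ell2 w ` B'"
      using B(1,2) finite_subset_image[of B "l2_of_ell2 w"] unfolding eigenspace_laplacian by blast
    \<comment> \<open>an infinite independent set inside a finitely generated space is the contradiction\<close>
    have "S \<subseteq> span B'"
    proof
      fix s assume s: "s \<in> S"
      then obtain l where l: "\<bar>l\<bar> < d" "?A s = l *\<^sub>R s" using S(3) by blast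
      have s0: "s \<noteq> 0" using S(2) s by (auto simp: orthonormal_def)
      have "eigenvalue w (laplacian w) (1 - l)" using l s0 by (auto simp: eigenvalue_laplacian_iff)
      hence "1 - l = 1" using l(1) by (intro d(2) eigenvalue_in_spectrum) (auto simp: dist_real_def)
      hence "l2_of_ell2 w s \<in> eigenspace w (laplacian w) 1" using l(2) by (auto simp: eigenspace_laplacian)
      then obtain a where a: "\<And>x. l2_of_ell2 w s x = (\<Sum>b\<in>B. a b * b x)" using B(3) by blast
      have inj: "inj (l2_of_ell2 w)" using bij_betw_l2_of_ell2 by (simp add: bij_betw_def)
      have "l2_of_ell2 w s x = l2_of_ell2 w (\<Sum>b\<in>B'. a (l2_of_ell2 w b) *\<^sub>R b) x" for x
        using a[of x] inj_on_subset[OF inj subset_UNIV, of B']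
        by (simp add: B'(2) sum.reindex l2_of_ell2_sum)
      hence "s = (\<Sum>b\<in>B'. a (l2_of_ell2 w b) *\<^sub>R b)" by (intro injD[OF inj] ext)
      also have "\<dots> \<in> span B'" by (intro span_sum span_scale span_base)
      finally show "s \<in> span B'" .
    qed
    with S(1) show False using independent_span_bound[OF B'(1) orthonormal_independent[OF S(2)]] by blast
  qed
  with spec show ?thesis by (auto simp: ess_spectrum_def)
qed

end

section \<open>Limits along exhaustions\<close>

text \<open>
  The definite description in \<open>exhaustion_lim\<close> denotes the infimum of \<open>F\<close> over finite sets: by
  monotonicity \<open>F\<close> converges to it along every exhaustion, and an exhaustion \<open>K0\<close> exists, which
  makes this limit unique.
\<close>

lemma exhaustion_lim_zero_imp_small:
  fixes F :: "'v set \<Rightarrow> real"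
  assumes anti: "\<And>K K'. finite K' \<Longrightarrow> K \<subseteq> K' \<Longrightarrow> F K' \<le> F K"
    and nonneg: "\<And>K. finite K \<Longrightarrow> 0 \<le> F K"
    and ex: "exhaustion (K0 :: nat \<Rightarrow> 'v set)"
    and zero: "exhaustion_lim F = 0" and e: "e > 0"
  shows "\<exists>K. finite K \<and> F K < e"
proof -
  define L where "L = (INF K\<in>{K. finite K}. F K)"
  have bdd: "bdd_below (F ` {K. finite K})" using nonneg by (intro bdd_belowI2[where m = 0]) auto
  have lim: "(\<lambda>n. F (K n)) \<longlonglongrightarrow> L" if K: "exhaustion K" for K
  proof (rule LIMSEQ_I)
    fix r :: real assume r: "r > 0"
    have "L < L + r" using r by simp
    then obtain S where S: "finite S" "F S < L + r"
      using cINF_less_iff[OF _ bdd, of "L + r"] unfolding L_def by auto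
    have "S \<subseteq> (\<Union>n. K n)" using K by (simp add: exhaustion_def)
    have "\<exists>N. S \<subseteq> K N"
      using S(1) \<open>S \<subseteq> (\<Union>n. K n)\<close>
    proof (induction S)
      case (insert x S)
      then obtain M N where "x \<in> K M" "S \<subseteq> K N" by auto
      moreover have "K M \<subseteq> K (max M N)" "K N \<subseteq> K (max M N)"
        using K by (simp_all add: exhaustion_def incseqD)
      ultimately show ?case by (intro exI[of _ "max M N"]) auto
    qed auto
    then obtain N where N: "S \<subseteq> K N" by blast
    have "norm (F (K n) - L) < r" if n: "n \<ge> N" for n
    proof -
      have fin: "finite (K n)" using K by (simp add: exhaustion_def)
      have "S \<subseteq> K n" using N n K incseqD[of K N n] by (auto simp: exhaustion_def)
      hence "F (K n) \<le> F S" using fin by (rule anti[rotated])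
      moreover have "L \<le> F (K n)" unfolding L_def using bdd fin by (intro cINF_lower) auto
      ultimately show ?thesis using S(2) by simp
    qed
    thus "\<exists>N. \<forall>n\<ge>N. norm (F (K n) - L) < r" by blast
  qed
  have "exhaustion_lim F = L" unfolding exhaustion_lim_def
  proof (rule the_equality)
    show "\<forall>K. exhaustion K \<longrightarrow> (\<lambda>n. F (K n)) \<longlonglongrightarrow> L" using lim by blast
    show "L' = L" if "\<forall>K. exhaustion K \<longrightarrow> (\<lambda>n. F (K n)) \<longlonglongrightarrow> L'" for L'
      using that ex lim[OF ex] LIMSEQ_unique by blast
  qed
  hence "L < e" using zero e by simp
  thus ?thesis using cINF_less_iff[OF _ bdd, of e] unfolding L_def by auto
qed

context infinite_weighted_graph
begin

text \<open>
  The balls around \<open>x0\<close> are finite by local finiteness and exhaust the graph by connectedness.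
\<close>

lemma exhaustion_balls: "exhaustion (\<lambda>n. \<Union>k\<le>n. (edges w ^^ k) `` {x0})"
  unfolding exhaustion_def
proof (intro conjI allI)
  show "incseq (\<lambda>n. \<Union>k\<le>n. (edges w ^^ k) `` {x0})" by (rule incseq_SucI) (auto intro: le_SucI)
  have "finite ((edges w ^^ k) `` {x0})" for k
  proof (induction k)
    case (Suc k)
    have "(edges w ^^ Suc k) `` {x0} = (\<Union>x\<in>(edges w ^^ k) `` {x0}. nbrs w x)"
      by (auto simp: nbrs_def)
    thus ?case using Suc locally_finite by simp
  qed auto
  thus "finite (\<Union>k\<le>n. (edges w ^^ k) `` {x0})" for n by auto
  show "(\<Union>n. \<Union>k\<le>n. (edges w ^^ k) `` {x0}) = UNIV"
  proof (intro equalityI subsetI)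
    fix x
    obtain n where "(x0, x) \<in> edges w ^^ n" using connected[of x0 x] by (auto simp: rtrancl_power)
    thus "x \<in> (\<Union>n. \<Union>k\<le>n. (edges w ^^ k) `` {x0})" by auto
  qed auto
qed

text \<open>
  The supremum is antitone in \<open>K\<close>, and nonnegative because the complement of a finite set of vertices
  is not empty. The instances of interest are \<open>m = mu_minus w x0\<close> and \<open>m = mu_zero w x0\<close>.
\<close>

lemma ratio_small_off_finite_set:
  assumes m: "\<And>x. 0 \<le> m x" "\<And>x. m x \<le> mu w x"
    and lim: "exhaustion_lim (\<lambda>K. SUP x\<in>UNIV - K. m x / mu w x) = 0" and e: "e > 0"
  shows "\<exists>K. finite K \<and> (\<forall>x. x \<notin> K \<longrightarrow> m x \<le> e * mu w x)"
proof -
  let ?F = "\<lambda>K. SUP x\<in>UNIV - K. m x / mu w x"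
  have le1: "m x / mu w x \<le> 1" for x using m(2)[of x] mu_pos[of x] by simp
  hence bdd: "bdd_above ((\<lambda>x. m x / mu w x) ` A)" for A by (intro bdd_aboveI2[where M = 1])
  have ne: "UNIV - K \<noteq> {}" if "finite K" for K :: "'v set"
    using Diff_infinite_finite[OF that infinite_vertices] by (rule infinite_imp_nonempty)
  have "\<exists>K. finite K \<and> ?F K < e"
  proof (rule exhaustion_lim_zero_imp_small[OF _ _ exhaustion_balls lim e])
    show "?F K' \<le> ?F K" if "finite K'" "K \<subseteq> K'" for K K'
      using that ne bdd by (intro cSUP_subset_mono) auto
    show "0 \<le> ?F K" if K: "finite K" for K
    proof -
      obtain x where "x \<in> UNIV - K" using ne[OF K] by blast
      moreover have "0 \<le> m x / mu w x" using m(1) by simp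
      ultimately show ?thesis by (intro cSUP_upper2[OF bdd])
    qed
  qed
  then obtain K where K: "finite K" "?F K < e" by blast
  have "m x \<le> e * mu w x" if "x \<notin> K" for x
  proof -
    have "m x / mu w x \<le> ?F K" using that by (intro cSUP_upper bdd) auto
    hence "m x / mu w x \<le> e" using K(2) by simp
    thus ?thesis using mu_pos[of x] by (simp add: pos_divide_le_eq)
  qed
  thus ?thesis using K(1) by blast
qed

end

section \<open>The essential spectrum\<close>

theorem corollary10p2:
  fixes w :: "'v \<Rightarrow> 'v \<Rightarrow> real" and x0 :: 'v
  assumes "weighted_graph w"
    and "infinite (UNIV :: 'v set)"
    and "M_minus_inf w x0 = 0"
    and "kappa_inf w x0 = 0"
  shows "ess_spectrum w (laplacian w) = {1}"
proof -
  interpret weighted_graph w by fact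
  interpret infinite_weighted_graph w by unfold_locales fact
  have comp: "compact_op (average_op w)"
  proof (rule compact_average_op)
    fix e :: real assume e: "e > 0"
    obtain K1 where K1: "finite K1" "\<forall>x. x \<notin> K1 \<longrightarrow> mu_minus w x0 x \<le> e * mu w x"
      using ratio_small_off_finite_set[OF mu_minus_bounds assms(3)[unfolded M_minus_inf_def] e] by blast
    obtain K2 where K2: "finite K2" "\<forall>x. x \<notin> K2 \<longrightarrow> mu_zero w x0 x \<le> e * mu w x"
      using ratio_small_off_finite_set[OF mu_zero_bounds assms(4)[unfolded kappa_inf_def] e] by blast
    show "\<exists>K. finite K \<and> (\<forall>x. x \<notin> K \<longrightarrow> mu_minus w x0 x \<le> e * mu w x \<and> mu_zero w x0 x \<le> e * mu w x)"
      using K1 K2 by (intro exI[of _ "K1 \<union> K2"]) auto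
  qed
  have "c = 1" if c: "c \<in> ess_spectrum w (laplacian w)" for c
  proof (rule ccontr)
    assume "c \<noteq> 1"
    with c show False
      using spectrum_isolated[OF comp] spectrum_imp_eigenvalue[OF comp] eigenspace_finite_multiplicity[OF comp]
      by (auto simp: ess_spectrum_def)
  qed
  thus ?thesis using one_in_ess_spectrum[OF comp] by blast
qed

end
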